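(* Let $B$ be a stationary Bratteli diagram such that the tail equivalence relation $\mathcal R$ on $X_B$ is aperiodic and the incidence matrix $F$ satisfies condition (P). Let $A=F^T$, let $D=\{x\in core(A):\ \sum_{w\in V_1}h^{(1)}_w x_w=1\}$, and let $\xi_1,\dots,\xi_k$ be the extreme vectors of the cone $core(A)$ (one on each extreme ray), normalized so that $\sum_{w\in V_1}h_w^{(1)}(\xi_i)_w=1$. Then there is a one-to-one correspondence between vectors $p^{(1)}\in D$ and $\mathcal R$-invariant Borel probability measures $\mu$ on $X_B$, given by the rule $$\mu\ \leftrightarrow\ p^{(1)}=\bigl(\mu(X^{(1)}_w)/h^{(1)}_w\bigr)_{w\in V_1}.$$ Furthermore, the ergodic measures correspond to the extreme vectors $\{\xi_1,\dots,\xi_k\}$. In particular, there exist exactly $k$ ergodic $\mathcal R$-invariant probability measures.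
   Context: A Bratteli diagram $B=(V,E)$ is an infinite graph with vertex set $V=\bigsqcup_{i\ge 0}V_i$ and edge set $E=\bigsqcup_{i\ge1}E_i$, all $V_i,E_i$ finite, $V_0=\{v_0\}$, with range and source maps $r,s:E\to V$ such that $r(E_i)=V_i$, $s(E_i)=V_{i-1}$, $s^{-1}(v)\ne\emptyset$ for all $v\in V$ and $r^{-1}(v')\neq\emptyset$ for all $v'\in V\setminus V_0$. $X_B$ is the set of infinite paths $x=(x_i)_{i\ge1}$, $x_i\in E_i$, $r(x_i)=s(x_{i+1})$, with the topology generated by cylinder sets; it is assumed to have no isolated points. The incidence matrix $F_n$ ($n\ge1$) is the $|V_{n+1}|\times|V_n|$ matrix whose $(v,w)$ entry is the number of edges $e\in E_{n+1}$ with $r(e)=v$, $s(e)=w$. $B$ is stationary if $F_n=F_1=:F$ for all $n\ge1$; then every $V_n$, $n\ge 1$, is identified with $\{1,\dots,N\}$. For $w\in V_n$, $X^{(n)}_w=\{x\in X_B: r(x_n)=w\}$ and $h^{(n)}_w$ is the number of paths from $v_0$ to $w$. Paths $x,y\in X_B$ are tail equivalent, $(x,y)\in\mathcal R$, if $x_i=y_i$ for all large $i$. $\mathcal R$ is aperiodic if all its classes are infinite. A finite Borel measure $\mu$ is $\mathcal R$-invariant if $\mu$ takes the same value on any two cylinder sets given by finite paths from $v_0$ to the same vertex (equivalently, it is invariant under every Borel action of a countable group whose orbit equivalence relation is $\mathcal R$). It is ergodic if every $\mathcal R$-saturated Borel set is null or conull. Condition (P): Let $G(F)$ be the directed graph on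 $\{1,\dots,N\}$ with an arrow $i\to j$ iff $F_{ij}>0$; $i,j$ are equivalent if $i=j$ or there are paths in $G(F)$ from $i$ to $j$ and from $j$ to $i$. Let $\mathcal E_1,\dots,\mathcal E_m$ be the equivalence classes and $F_i$ the restriction of $F$ to $\mathcal E_i$. (P) says that the vertices and classes are numbered so that $F$ is block lower triangular with diagonal blocks $F_1,\dots,F_m$, where exactly the first $s$ classes have no arrows of $G(F)$ to other classes (off-diagonal blocks in the first $s$ block rows vanish and each later block row has a nonzero off-diagonal block), and every nonzero $F_i$ is primitive (some power is strictly positive). $core(A)=\bigcap_{k\ge1}A^k(\mathbb R^N_+)$, where $\mathbb R^N_+=\{x: x_i\ge0\ \forall i\}$. A subcone $Q$ of a convex cone $C$ is a face if $x\in Q$, $y\in C$, $x-y\in C$ imply $y\in Q$; a nonzero $x\in C$ is an extreme vector if the smallest face containing $x$ is the ray $\{ax:a\ge0\}$, called an extreme ray. *)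

theory Defs
  imports "HOL-Probability.Probability"
begin

text \<open>
  Edge levels are shifted by one: \<open>edges B n\<close> is the set usually written \<open>E_(n+1)\<close>, that is,
  the edges from level \<open>n\<close> to level \<open>n + 1\<close>. Accordingly, entry \<open>x i\<close> of an infinite
  path is the edge usually written \<open>x_(i+1)\<close>. Only the values of \<open>src\<close> and \<open>rng\<close> on
  edges of the diagram matter.
\<close>

record ('v, 'e) bratteli =
  root :: 'v
  verts :: "nat \<Rightarrow> 'v set"
  edges :: "nat \<Rightarrow> 'e set"
  src :: "'e \<Rightarrow> 'v"
  rng :: "'e \<Rightarrow> 'v"

definition inf_paths :: "('v, 'e) bratteli \<Rightarrow> (nat \<Rightarrow> 'e) set" where
  "inf_paths B = {x. \<forall>i. x i \<in> edges B i \<and> rng B (x i) = src B (x (Suc i))}"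

text \<open>Finite paths starting at the root; the empty list is the path of length 0.\<close>

definition finite_paths :: "('v, 'e) bratteli \<Rightarrow> 'e list set" where
  "finite_paths B =
     {es. (\<forall>i < length es. es ! i \<in> edges B i) \<and>
          (\<forall>i. Suc i < length es \<longrightarrow> rng B (es ! i) = src B (es ! Suc i))}"

definition paths_to :: "('v, 'e) bratteli \<Rightarrow> 'v \<Rightarrow> 'e list set" where
  "paths_to B w = {es \<in> finite_paths B. (if es = [] then root B else rng B (last es)) = w}"

text \<open>
  For \<open>w\<close> in level \<open>n\<close> this is the number usually written with an upper index \<open>n\<close>; since the
  levels are disjoint, \<open>w\<close> determines \<open>n\<close>.
\<close>

definition height :: "('v, 'e) bratteli \<Rightarrow> 'v \<Rightarrow> nat" where
  "height B w = card (paths_to B w)"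

definition cylinder :: "('v, 'e) bratteli \<Rightarrow> 'e list \<Rightarrow> (nat \<Rightarrow> 'e) set" where
  "cylinder B es = {x \<in> inf_paths B. \<forall>i < length es. x i = es ! i}"

definition path_topology :: "('v, 'e) bratteli \<Rightarrow> (nat \<Rightarrow> 'e) topology" where
  "path_topology B = topology_generated_by (cylinder B ` finite_paths B)"

definition path_borel :: "('v, 'e) bratteli \<Rightarrow> (nat \<Rightarrow> 'e) measure" where
  "path_borel B = sigma (inf_paths B) {U. openin (path_topology B) U}"

definition bratteli_diagram :: "('v, 'e) bratteli \<Rightarrow> bool" where
  "bratteli_diagram B \<longleftrightarrow>
     (\<forall>n. finite (verts B n)) \<and> (\<forall>n. finite (edges B n)) \<and>
     disjoint_family (verts B) \<and> disjoint_family (edges B) \<and>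
     verts B 0 = {root B} \<and>
     (\<forall>n. rng B ` edges B n = verts B (Suc n)) \<and>
     (\<forall>n. src B ` edges B n = verts B n) \<and>
     (\<forall>v \<in> (\<Union>n. verts B n). \<exists>e \<in> (\<Union>n. edges B n). src B e = v) \<and>
     (\<forall>v \<in> (\<Union>n. verts B n) - verts B 0. \<exists>e \<in> (\<Union>n. edges B n). rng B e = v) \<and>
     (\<forall>x \<in> inf_paths B. \<not> openin (path_topology B) {x})"

text \<open>The set \<open>{x. r(x_n) = w}\<close>, for \<open>n \<ge> 1\<close> and \<open>w\<close> in level \<open>n\<close>.\<close>

definition tower :: "('v, 'e) bratteli \<Rightarrow> nat \<Rightarrow> 'v \<Rightarrow> (nat \<Rightarrow> 'e) set" where
  "tower B n w = {x \<in> inf_paths B. rng B (x (n - 1)) = w}"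

definition incidence :: "('v, 'e) bratteli \<Rightarrow> nat \<Rightarrow> 'v \<Rightarrow> 'v \<Rightarrow> nat" where
  "incidence B n v w = card {e \<in> edges B n. rng B e = v \<and> src B e = w}"

text \<open>
  Stationarity, with \<open>F\<close> the common incidence matrix. The finite type \<open>'n\<close> plays the role of
  the index set \<open>{1..N}\<close>, and \<open>lab n\<close> is the identification of \<open>'n\<close> with level \<open>n\<close>.
\<close>

definition stationary ::
  "('v, 'e) bratteli \<Rightarrow> (nat \<Rightarrow> 'n::finite \<Rightarrow> 'v) \<Rightarrow> nat^'n^'n \<Rightarrow> bool" where
  "stationary B lab F \<longleftrightarrow>
     (\<forall>n\<ge>1. bij_betw (lab n) UNIV (verts B n)) \<and>
     (\<forall>n\<ge>1. \<forall>i j. incidence B n (lab (Suc n) i) (lab n j) = F $ i $ j)"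

definition tail_equiv :: "('v, 'e) bratteli \<Rightarrow> ((nat \<Rightarrow> 'e) \<times> (nat \<Rightarrow> 'e)) set" where
  "tail_equiv B = {(x, y). x \<in> inf_paths B \<and> y \<in> inf_paths B \<and> (\<exists>n. \<forall>i\<ge>n. x i = y i)}"

definition aperiodic :: "('v, 'e) bratteli \<Rightarrow> bool" where
  "aperiodic B \<longleftrightarrow> (\<forall>x \<in> inf_paths B. infinite (tail_equiv B `` {x}))"

definition invariant_probs :: "('v, 'e) bratteli \<Rightarrow> (nat \<Rightarrow> 'e) measure set" where
  "invariant_probs B =
     {\<mu>. prob_space \<mu> \<and> space \<mu> = inf_paths B \<and> sets \<mu> = sets (path_borel B) \<and>
         (\<forall>n. \<forall>w \<in> verts B n. \<forall>es \<in> paths_to B w. \<forall>es' \<in> paths_to B w.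
            measure \<mu> (cylinder B es) = measure \<mu> (cylinder B es'))}"

definition ergodic :: "('v, 'e) bratteli \<Rightarrow> (nat \<Rightarrow> 'e) measure \<Rightarrow> bool" where
  "ergodic B \<mu> \<longleftrightarrow>
     (\<forall>S \<in> sets \<mu>. tail_equiv B `` S \<subseteq> S \<longrightarrow>
        measure \<mu> S = 0 \<or> measure \<mu> (space \<mu> - S) = 0)"

definition arrows :: "nat^'n^'n \<Rightarrow> ('n \<times> 'n) set" where
  "arrows F = {(i, j). F $ i $ j > 0}"

definition communicating :: "nat^'n^'n \<Rightarrow> ('n \<times> 'n) set" where
  "communicating F = {(i, j). i = j \<or> (i, j) \<in> (arrows F)\<^sup>+ \<and> (j, i) \<in> (arrows F)\<^sup>+}"

definition zero_block :: "nat^'n^'n \<Rightarrow> 'n set \<Rightarrow> 'n set \<Rightarrow> bool" where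
  "zero_block F C D \<longleftrightarrow> (\<forall>i\<in>C. \<forall>j\<in>D. F $ i $ j = 0)"

definition mat_power :: "'a::semiring_1^'n^'n \<Rightarrow> nat \<Rightarrow> 'a^'n^'n" where
  "mat_power A k = (((**) A) ^^ k) (mat 1)"

text \<open>
  The restriction of \<open>F\<close> to \<open>C\<close> is padded with zeros to a matrix over the full index set;
  for \<open>k \<ge> 1\<close> this does not affect the entries of its powers inside \<open>C\<close>.
\<close>

definition restrict_mat :: "nat^'n^'n \<Rightarrow> 'n set \<Rightarrow> nat^'n^'n" where
  "restrict_mat F C = (\<chi> i j. if i \<in> C \<and> j \<in> C then F $ i $ j else 0)"

definition primitive_on :: "nat^'n^'n \<Rightarrow> 'n set \<Rightarrow> bool" where
  "primitive_on F C \<longleftrightarrow>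
     (\<exists>k\<ge>1. \<forall>i\<in>C. \<forall>j\<in>C. mat_power (restrict_mat F C) k $ i $ j > 0)"

text \<open>
  Only the classes are numbered, as \<open>cl 1, \<dots>, cl m\<close>. The numbering of the vertices is any one
  that lists the classes consecutively in this order; block triangularity does not depend on
  the order inside a class.
\<close>

definition condition_P :: "nat^'n^'n \<Rightarrow> bool" where
  "condition_P F \<longleftrightarrow>
     (\<exists>(m::nat) s cl. s \<le> m \<and> bij_betw cl {1..m} (UNIV // communicating F) \<and>
        (\<forall>a\<in>{1..m}. \<forall>b\<in>{1..m}. a < b \<longrightarrow> zero_block F (cl a) (cl b)) \<and>
        (\<forall>a\<in>{1..s}. \<forall>b\<in>{1..m}. a \<noteq> b \<longrightarrow> zero_block F (cl a) (cl b)) \<and>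
        (\<forall>a\<in>{s+1..m}. \<exists>b\<in>{1..m}. a \<noteq> b \<and> \<not> zero_block F (cl a) (cl b)) \<and>
        (\<forall>a\<in>{1..m}. \<not> zero_block F (cl a) (cl a) \<longrightarrow> primitive_on F (cl a)))"

definition core :: "real^'n^'n \<Rightarrow> (real^'n) set" where
  "core A = (\<Inter>k\<in>{1..}. (\<lambda>x. mat_power A k *v x) ` {x. \<forall>i. 0 \<le> x $ i})"

text \<open>
  Faces of convex cones in the order-theoretic sense, hence not defined via \<^const>\<open>face_of\<close>.
\<close>

definition cone_face :: "'a::real_vector set \<Rightarrow> 'a set \<Rightarrow> bool" where
  "cone_face Q C \<longleftrightarrow>
     convex_cone Q \<and> Q \<subseteq> C \<and> (\<forall>x y. x \<in> Q \<and> y \<in> C \<and> x - y \<in> C \<longrightarrow> y \<in> Q)"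

text \<open>Faces are closed under intersection, so the intersection below is the smallest face.\<close>

definition extreme_vector :: "'a::real_vector \<Rightarrow> 'a set \<Rightarrow> bool" where
  "extreme_vector x C \<longleftrightarrow>
     x \<in> C \<and> x \<noteq> 0 \<and> \<Inter>{Q. cone_face Q C \<and> x \<in> Q} = {a *\<^sub>R x |a. 0 \<le> a}"

end

theory Submission
  imports Defs
begin

text \<open>
  The values of an invariant measure on cylinders depend only on the end vertex, so they are
  vectors \<open>p n\<close> with \<open>A (p (n + 1)) = p n\<close>. As \<open>A\<close> maps its core bijectively onto itself, the first
  vector determines the others, and every normalised vector of the core arises, from a Markov
  measure. A decomposition of the first vector in the core is a decomposition of the measure;
  an ergodic measure has none, since an invariant measure absolutely continuous with respect to
  it has a density that is constant on tail classes.
\<close>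

subsection \<open>The core of a nonnegative matrix\<close>

text \<open>The matrix \<open>A\<close> may be singular. So it is not clear that a vector with
  nonnegative preimages of every order has preimages that fit together, nor that a measure is
  determined by its first vector. Both follow because, on the range of a high power of
  \<open>A\<close>, all candidate preimages coincide. Invariance speaks of cylinders, ergodicity of
  saturated Borel sets. The bridge is the countable family of involutions that exchange two finite
  paths with a common end: they preserve every invariant measure, and any two tail equivalent paths
  are related by one of them. Countability turns statements that hold almost everywhere for each
  involution into a genuinely saturated set. The Markov measure is the image of a product measure
  indexed by vertices. A path leaves a vertex only once, so the probability of a cylinder is a
  product over independent coordinates. The normalisation by \<open>h\<close> is additivity at the
  root: \<open>h\<close> counts the edges from the root to each vertex of level 1.\<close>

lemma mat_power_mult_vec: "mat_power A k *v x = ((*v) A ^^ k) x"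
  by (induction k) (simp_all add: mat_power_def matrix_vector_mul_assoc [symmetric])

lemma mem_core_iff:
  "x \<in> core A \<longleftrightarrow> (\<forall>k\<ge>1. \<exists>y. (\<forall>i. 0 \<le> y $ i) \<and> x = ((*v) A ^^ k) y)"
  by (auto simp: core_def mat_power_mult_vec image_iff)

lemma linear_matrix_funpow: "linear ((*v) (A :: real^'n^'n) ^^ k)"
proof (induction k)
  case 0
  show ?case by (simp add: linear_id flip: id_def)
next
  case (Suc k)
  show ?case
    unfolding funpow.simps by (rule linear_compose [OF Suc]) simp
qed

lemma convex_cone_core: "convex_cone (core (A :: real^'n^'n))"
  unfolding convex_cone_iff
proof (intro conjI ballI allI impI)
  show "0 \<in> core A"
    unfolding mem_core_iff
    using linear_0 [OF linear_matrix_funpow] by (metis zero_index order_refl)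
next
  fix x y assume "x \<in> core A" "y \<in> core A"
  show "x + y \<in> core A"
    unfolding mem_core_iff
  proof (intro allI impI)
    fix k :: nat assume "1 \<le> k"
    with \<open>x \<in> core A\<close> \<open>y \<in> core A\<close> obtain a b
      where "\<forall>i. 0 \<le> a $ i" "x = ((*v) A ^^ k) a" "\<forall>i. 0 \<le> b $ i" "y = ((*v) A ^^ k) b"
      unfolding mem_core_iff by meson
    then show "\<exists>z. (\<forall>i. 0 \<le> z $ i) \<and> x + y = ((*v) A ^^ k) z"
      by (intro exI [of _ "a + b"]) (simp add: linear_add [OF linear_matrix_funpow])
  qed
next
  fix x and c :: real assume "x \<in> core A" "0 \<le> c"
  show "c *\<^sub>R x \<in> core A"
    unfolding mem_core_iff
  proof (intro allI impI)
    fix k :: nat assume "1 \<le> k"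
    with \<open>x \<in> core A\<close> obtain a where "\<forall>i. 0 \<le> a $ i" "x = ((*v) A ^^ k) a"
      unfolding mem_core_iff by meson
    then show "\<exists>z. (\<forall>i. 0 \<le> z $ i) \<and> c *\<^sub>R x = ((*v) A ^^ k) z"
      using \<open>0 \<le> c\<close>
      by (intro exI [of _ "c *\<^sub>R a"]) (simp add: linear_cmul [OF linear_matrix_funpow])
  qed
qed

text \<open>The vectors \<open>y\<close> with \<open>x - y\<close> in the cone lie in every face
  through \<open>x\<close>. If they are all multiples of \<open>x\<close>, the ray is itself a face:
  a decomposition of a positive multiple of \<open>x\<close> is rescaled to one of \<open>x\<close>,
  and pointedness settles the apex.\<close>

lemma extreme_vector_iff:
  assumes C: "convex_cone C" and pointed: "\<And>x. x \<in> C \<Longrightarrow> - x \<in> C \<Longrightarrow> x = 0"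
  shows "extreme_vector x C \<longleftrightarrow>
    x \<in> C \<and> x \<noteq> 0 \<and> (\<forall>y\<in>C. x - y \<in> C \<longrightarrow> (\<exists>a\<ge>0. y = a *\<^sub>R x))"
    (is "?L \<longleftrightarrow> ?R")
proof
  assume L: ?L
  show ?R
  proof (intro conjI ballI impI)
    show "x \<in> C" "x \<noteq> 0" using L by (auto simp: extreme_vector_def)
    fix y assume "y \<in> C" "x - y \<in> C"
    then have "y \<in> \<Inter>{Q. cone_face Q C \<and> x \<in> Q}"
      by (auto simp: cone_face_def)
    then show "\<exists>a\<ge>0. y = a *\<^sub>R x" using L by (auto simp: extreme_vector_def)
  qed
next
  assume R: ?R
  let ?ray = "{a *\<^sub>R x |a. 0 \<le> a}"
  have add: "u + v \<in> C" if "u \<in> C" "v \<in> C" for u v using C that by (auto simp: convex_cone_iff)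
  have scale: "c *\<^sub>R u \<in> C" if "u \<in> C" "0 \<le> c" for u c
    using C that by (auto simp: convex_cone_iff)
  have "cone_face ?ray C"
    unfolding cone_face_def
  proof (intro conjI allI impI)
    show "convex_cone ?ray"
      unfolding convex_cone_iff
    proof (intro conjI ballI allI impI)
      show "0 \<in> ?ray" by (auto intro: exI [of _ 0])
      show "u + v \<in> ?ray" if "u \<in> ?ray" "v \<in> ?ray" for u v
        using that by (smt (verit) mem_Collect_eq scaleR_left.add)
      show "c *\<^sub>R u \<in> ?ray" if "u \<in> ?ray" "0 \<le> c" for u c
        using that by (smt (verit) mem_Collect_eq mult_nonneg_nonneg scaleR_scaleR)
    qed
    show "?ray \<subseteq> C" using R scale by auto
    fix z y assume *: "z \<in> ?ray \<and> y \<in> C \<and> z - y \<in> C"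
    then obtain a where a: "0 \<le> a" "z = a *\<^sub>R x" by auto
    show "y \<in> ?ray"
    proof (cases "a = 0")
      case True
      then have "y = 0" using * a pointed by auto
      then show ?thesis by (auto intro: exI [of _ 0])
    next
      case False
      with a have "0 < a" by simp
      have "(1 / a) *\<^sub>R y \<in> C" using * \<open>0 < a\<close> by (intro scale) auto
      moreover have "x - (1 / a) *\<^sub>R y = (1 / a) *\<^sub>R (z - y)"
        using \<open>0 < a\<close> a by (simp add: scaleR_diff_right)
      then have "x - (1 / a) *\<^sub>R y \<in> C" using * \<open>0 < a\<close> scale [of "z - y" "1 / a"] by auto
      ultimately obtain b where "0 \<le> b" "(1 / a) *\<^sub>R y = b *\<^sub>R x" using R by blast
      then have "a *\<^sub>R (1 / a) *\<^sub>R y = (a * b) *\<^sub>R x" by simp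
      then have "y = (a * b) *\<^sub>R x" using \<open>0 < a\<close> by simp
      then show ?thesis using \<open>0 \<le> b\<close> \<open>0 < a\<close> by auto
    qed
  qed
  moreover have "x \<in> ?ray" by (auto intro: exI [of _ 1])
  moreover have "?ray \<subseteq> Q" if "cone_face Q C" "x \<in> Q" for Q
    using that by (auto simp: cone_face_def convex_cone_iff)
  ultimately show ?L
    using R unfolding extreme_vector_def by blast
qed

text \<open>With positive weights, \<open>h \<bullet> y = 1\<close> bounds each coordinate of a
  nonnegative vector by \<open>1 / h $ i\<close>. It is used for the weights \<open>h\<close>, for
  the column weights of a power of \<open>A\<close> and for the standard simplex.\<close>

lemma compact_weighted_simplex:
  fixes h :: "real^'n"
  assumes h: "\<And>i. 0 < h $ i"
  shows "compact {y. (\<forall>i. 0 \<le> y $ i) \<and> h \<bullet> y = 1}" (is "compact ?S")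
  unfolding compact_eq_bounded_closed
proof
  have "norm y \<le> (\<Sum>i\<in>UNIV. 1 / h $ i)" if "y \<in> ?S" for y
  proof -
    have "\<bar>y $ i\<bar> \<le> 1 / h $ i" for i
    proof -
      have "h $ i * y $ i \<le> (\<Sum>i\<in>UNIV. h $ i * y $ i)"
        using that h by (intro member_le_sum) (auto simp: less_imp_le)
      also have "\<dots> = 1" using that by (simp add: inner_vec_def)
      finally show ?thesis using that h [of i] by (simp add: field_simps)
    qed
    then show ?thesis
      using norm_le_l1_cart [of y] sum_mono [of UNIV "\<lambda>i. \<bar>y $ i\<bar>" "\<lambda>i. 1 / h $ i"] by force
  qed
  then show "bounded ?S" unfolding bounded_iff by blast
  show "closed ?S"
    by (intro closed_Collect_conj closed_Collect_all closed_Collect_le closed_Collect_eq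
        continuous_intros)
qed

text \<open>Several vectors are packed into the rows of one matrix, so that one subsequence makes
  all of them converge.\<close>

lemma compact_rows:
  fixes S :: "(real^'n) set"
  assumes "compact S"
  shows "compact {V :: real^'n^'m. \<forall>j. V $ j \<in> S}"
  unfolding compact_eq_bounded_closed
proof
  from assms obtain b where b: "\<And>y. y \<in> S \<Longrightarrow> norm y \<le> b"
    by (meson bounded_iff compact_imp_bounded)
  have "norm V \<le> (\<Sum>j\<in>(UNIV :: 'm set). b)" if "\<forall>j. V $ j \<in> S" for V :: "real^'n^'m"
  proof -
    have "norm V \<le> (\<Sum>j\<in>UNIV. norm (V $ j))"
      unfolding norm_vec_def by (rule L2_set_le_sum) simp
    also have "\<dots> \<le> (\<Sum>j\<in>(UNIV :: 'm set). b)" using that b by (intro sum_mono) auto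
    finally show ?thesis .
  qed
  then show "bounded {V :: real^'n^'m. \<forall>j. V $ j \<in> S}" unfolding bounded_iff by blast
  have "closed ((\<lambda>V :: real^'n^'m. V $ j) -` S)" for j
    using assms by (intro continuous_closed_vimage compact_imp_closed continuous_intros) auto
  then have "closed (\<Inter>j. (\<lambda>V :: real^'n^'m. V $ j) -` S)" by (intro closed_INT ballI)
  also have "(\<Inter>j. (\<lambda>V. V $ j) -` S) = {V :: real^'n^'m. \<forall>j. V $ j \<in> S}" by auto
  finally show "closed {V :: real^'n^'m. \<forall>j. V $ j \<in> S}" .
qed

text \<open>Without zero columns, a nonnegative matrix kills no nonzero nonnegative vector, so
  images can be normalised. For a transposed incidence matrix, column \<open>j\<close> counts the
  edges that end at \<open>j\<close>.\<close>

locale nonneg_matrix =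
  fixes A :: "real^'n^'n"
  assumes nonneg: "\<And>i j. 0 \<le> A $ i $ j"
    and column_nonzero: "\<And>j. \<exists>i. 0 < A $ i $ j"
begin

abbreviation pow :: "nat \<Rightarrow> real^'n \<Rightarrow> real^'n" where
  "pow k \<equiv> (*v) A ^^ k"

lemma mult_nonneg_vec: "\<forall>i. 0 \<le> y $ i \<Longrightarrow> 0 \<le> (A *v y) $ i"
  by (simp add: matrix_vector_mult_def sum_nonneg nonneg)

lemma mult_nonzero_vec:
  assumes "\<forall>i. 0 \<le> y $ i" "y \<noteq> 0"
  shows "A *v y \<noteq> 0"
proof -
  obtain j where "y $ j \<noteq> 0" using assms(2) by (auto simp: vec_eq_iff)
  with assms(1) have "0 < y $ j" by (metis order_le_less)
  obtain i where "0 < A $ i $ j" using column_nonzero by blast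
  then have "0 < A $ i $ j * y $ j" using \<open>0 < y $ j\<close> by simp
  also have "\<dots> \<le> (A *v y) $ i"
    unfolding matrix_vector_mult_def using assms nonneg by (auto intro!: member_le_sum)
  finally show ?thesis by (metis less_irrefl zero_index)
qed

lemma pow_nonneg: "\<forall>i. 0 \<le> y $ i \<Longrightarrow> 0 \<le> pow k y $ i"
  by (induction k arbitrary: i) (simp_all add: mult_nonneg_vec)

lemma pow_nonzero: "\<forall>i. 0 \<le> y $ i \<Longrightarrow> y \<noteq> 0 \<Longrightarrow> pow k y \<noteq> 0"
  by (induction k) (simp_all add: mult_nonzero_vec pow_nonneg)

lemma core_nonneg: "x \<in> core A \<Longrightarrow> 0 \<le> x $ i"
  unfolding mem_core_iff using pow_nonneg by blast

lemma core_pointed: "x \<in> core A \<Longrightarrow> - x \<in> core A \<Longrightarrow> x = 0"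
  using core_nonneg [of x] core_nonneg [of "- x"] by (simp add: vec_eq_iff) (meson order_antisym)

lemma extreme_vector_core_iff:
  "extreme_vector x (core A) \<longleftrightarrow>
    x \<in> core A \<and> x \<noteq> 0 \<and> (\<forall>y\<in>core A. x - y \<in> core A \<longrightarrow> (\<exists>a\<ge>0. y = a *\<^sub>R x))"
  using convex_cone_core core_pointed by (rule extreme_vector_iff)

text \<open>The kernels of the powers stabilise, so \<open>A\<close> is injective on the range of a high power.\<close>

lemma injective_on_range_pow: "\<exists>k. inj_on ((*v) A) (range (pow k))"
proof -
  define K where "K k = {x. pow k x = 0}" for k
  have sub: "subspace (K k)" for k
    unfolding K_def by (rule linear_subspace_kernel [OF linear_matrix_funpow])
  have mono: "K k \<subseteq> K (Suc k)" for k
    unfolding K_def by auto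
  have "\<exists>k. dim (K (Suc k)) \<le> dim (K k)"
  proof (rule ccontr)
    assume "\<nexists>k. dim (K (Suc k)) \<le> dim (K k)"
    then have less: "dim (K k) < dim (K (Suc k))" for k by (meson not_le)
    have "k \<le> dim (K k)" for k
    proof (induction k)
      case (Suc k)
      then show ?case using less [of k] by simp
    qed simp
    then show False
      using dim_subset_UNIV [of "K (Suc DIM(real^'n))"] by (metis Suc_n_not_le_n order_trans)
  qed
  then obtain k where "dim (K (Suc k)) \<le> dim (K k)" by blast
  then have eq: "K k = K (Suc k)" using sub mono by (metis subspace_dim_equal)
  have "inj_on ((*v) A) (range (pow k))"
  proof (rule inj_onI)
    fix x y assume "x \<in> range (pow k)" "y \<in> range (pow k)" and A: "A *v x = A *v y"
    then obtain u v where uv: "x = pow k u" "y = pow k v" by blast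
    then have "pow (Suc k) (u - v) = 0"
      using A by (simp add: linear_diff [OF linear_matrix_funpow] matrix_vector_mult_diff_distrib)
    then have "pow k (u - v) = 0" using eq unfolding K_def by blast
    then show "x = y" using uv by (simp add: linear_diff [OF linear_matrix_funpow])
  qed
  then show ?thesis ..
qed

lemma inj_on_core: "inj_on ((*v) A) (core A)"
proof -
  obtain k where "inj_on ((*v) A) (range (pow k))" using injective_on_range_pow by blast
  \<comment> \<open>The exponent is raised by one because \<open>core\<close> only uses positive
    exponents and the one obtained may be 0.\<close>
  then have k: "inj_on ((*v) A) (range (pow (Suc k)))"
    by (rule inj_on_subset) (metis funpow_Suc_right image_comp subset_UNIV image_mono)
  have "core A \<subseteq> range (pow (Suc k))"
    unfolding mem_core_iff subset_iff by (metis le_add1 plus_1_eq_Suc rangeI)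
  with k show ?thesis by (rule inj_on_subset)
qed

text \<open>The preimage \<open>pow k z\<close> of \<open>x\<close> is taken with \<open>k\<close>
  so large that \<open>A\<close> is injective on the range of \<open>pow k\<close>. For any
  \<open>j\<close> there is a preimage \<open>pow (k + j) w\<close> with nonnegative
  \<open>w\<close>. It lies in the same range, so it is the same vector, and this shows that the
  vector has a nonnegative preimage of order \<open>j\<close>.\<close>

lemma core_subset_image: "core A \<subseteq> (*v) A ` core A"
proof
  fix x assume x: "x \<in> core A"
  obtain k where k: "inj_on ((*v) A) (range (pow k))" using injective_on_range_pow by blast
  have pre: "\<exists>z. (\<forall>i. 0 \<le> z $ i) \<and> x = A *v pow j z" for j
    using x unfolding mem_core_iff by (metis comp_apply funpow.simps(2) le_add1 plus_1_eq_Suc)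
  from pre obtain z where z: "\<forall>i. 0 \<le> z $ i" "x = A *v pow k z" by blast
  have "pow k z \<in> core A"
    unfolding mem_core_iff
  proof (intro allI impI)
    fix j :: nat
    obtain w where w: "\<forall>i. 0 \<le> w $ i" "x = A *v pow (k + j) w" using pre by blast
    have "pow (k + j) w = pow k (pow j w)" by (simp add: funpow_add)
    then have "pow k z = pow (k + j) w" using k z w by (metis inj_onD rangeI)
    also have "\<dots> = pow j (pow k w)" by (simp add: funpow_add add.commute)
    finally show "\<exists>y. (\<forall>i. 0 \<le> y $ i) \<and> pow k z = pow j y" using pow_nonneg w by blast
  qed
  then show "x \<in> (*v) A ` core A" using z by blast
qed

text \<open>
  A normalised vector of the core is, for every \<open>k\<close>, a convex combination of the normalised
  columns of \<open>A ^ k\<close>. Passing to a limit along a subsequence, it is a convex combination of at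
  most \<open>N\<close> vectors of the core which do not depend on the vector.
\<close>

lemma finite_extreme_vectors_core:
  fixes h :: "real^'n"
  assumes h: "\<And>i. 0 < h $ i"
  shows "finite {x. extreme_vector x (core A) \<and> h \<bullet> x = 1}"
proof -
  let ?S = "{y. (\<forall>i. 0 \<le> y $ i) \<and> h \<bullet> y = 1}"
  \<comment> \<open>The total weight of column \<open>j\<close> of the \<open>k\<close>-th power.
    The normalisation divides by it, hence its positivity.\<close>
  define c where "c k j = h \<bullet> pow k (axis j 1)" for k j
  have c_pos: "0 < c k j" for k j
  proof -
    have nn: "\<forall>i. 0 \<le> pow k (axis j 1) $ i" by (intro allI pow_nonneg) (simp add: axis_def)
    have "pow k (axis j 1) \<noteq> 0" by (intro pow_nonzero) (simp_all add: axis_def vec_eq_iff)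
    then obtain i where "pow k (axis j 1) $ i \<noteq> 0" by (auto simp: vec_eq_iff)
    then have "0 < h $ i * pow k (axis j 1) $ i" using nn h by (metis mult_pos_pos order_le_less)
    also have "\<dots> \<le> c k j"
      unfolding c_def inner_vec_def inner_real_def
      using nn h by (intro member_le_sum) (auto simp: less_imp_le)
    finally show ?thesis .
  qed
  have expand: "pow k z = (\<Sum>j\<in>UNIV. z $ j *\<^sub>R pow k (axis j 1))" for k z
  proof -
    have "pow k z = pow k (\<Sum>j\<in>UNIV. z $ j *\<^sub>R axis j 1)"
      using basis_expansion [of z] by (simp add: scalar_mult_eq_scaleR)
    then show ?thesis
      by (simp add: linear_sum [OF linear_matrix_funpow] linear_cmul [OF linear_matrix_funpow])
  qed
  \<comment> \<open>The column weights are \<open>h\<close> moved across the inner product, so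
    \<open>pow k\<close> maps the simplex with weights \<open>c k\<close> into the one with weights
    \<open>h\<close>.\<close>
  have weight: "h \<bullet> pow k z = (\<chi> j. c k j) \<bullet> z" for k z
    by (subst expand) (simp add: inner_sum_right c_def inner_vec_def [of _ z] mult.commute)
  define V :: "nat \<Rightarrow> real^'n^'n" where
    "V k = (\<chi> j. (1 / c k j) *\<^sub>R pow k (axis j 1))" for k
  have V_S: "V k $ j \<in> ?S" for k j
    using c_pos [of k j] by (auto simp: V_def c_def intro!: divide_nonneg_pos pow_nonneg)
      (simp add: axis_def)
  have "compact {V :: real^'n^'n. \<forall>j. V $ j \<in> ?S}"
    by (rule compact_rows [OF compact_weighted_simplex [OF h]])
  then obtain W r where W: "strict_mono r" "(V \<circ> r) \<longlonglongrightarrow> W"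
    using compact_imp_seq_compact V_S unfolding seq_compact_def by (smt (verit) mem_Collect_eq)
  \<comment> \<open>From index \<open>m\<close> on, every normalised column is the image under
    \<open>pow m\<close> of a point of one fixed simplex. That image is compact, so the limit stays
    in it.\<close>
  have W_core: "W $ j \<in> core A" for j
    unfolding mem_core_iff
  proof (intro allI impI)
    fix m :: nat
    let ?T = "pow m ` {z. (\<forall>i. 0 \<le> z $ i) \<and> (\<chi> j. c m j) \<bullet> z = 1}"
    have "compact ?T"
      by (intro compact_continuous_image compact_weighted_simplex linear_continuous_on
          linear_linear [THEN iffD2] linear_matrix_funpow) (simp add: c_pos)
    then have "closed ?T" by (rule compact_imp_closed)
    moreover have "\<forall>\<^sub>F n in sequentially. (V \<circ> r) n $ j \<in> ?T"
    proof (rule eventually_sequentiallyI [of m])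
      fix n assume "m \<le> n"
      also have "n \<le> r n" using W(1) by (rule seq_suble)
      finally have "r n = m + (r n - m)" by simp
      then have "pow (r n) y = pow m (pow (r n - m) y)" for y by (metis comp_apply funpow_add)
      then have eq: "V (r n) $ j = pow m ((1 / c (r n) j) *\<^sub>R pow (r n - m) (axis j 1))"
        by (simp add: V_def linear_cmul [OF linear_matrix_funpow])
      have "(1 / c (r n) j) *\<^sub>R pow (r n - m) (axis j 1) \<in>
          {z. (\<forall>i. 0 \<le> z $ i) \<and> (\<chi> j. c m j) \<bullet> z = 1}" (is "?z \<in> _")
      proof -
        have "h \<bullet> pow m ?z = 1" using V_S [of "r n" j] eq by simp
        then show ?thesis
          using c_pos [of "r n" j]
          by (auto simp: weight intro!: divide_nonneg_pos pow_nonneg) (simp add: axis_def)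
      qed
      then show "(V \<circ> r) n $ j \<in> ?T" unfolding o_apply eq by (rule imageI)
    qed
    moreover have "(\<lambda>n. (V \<circ> r) n $ j) \<longlonglongrightarrow> W $ j" using W(2) by (rule tendsto_vec_nth)
    ultimately have "W $ j \<in> ?T" by (intro Lim_in_closed_set) auto
    then show "\<exists>y. (\<forall>i. 0 \<le> y $ i) \<and> W $ j = pow m y" by auto
  qed
  have W_norm: "h \<bullet> W $ j = 1" for j
  proof -
    have "(\<lambda>n. h \<bullet> (V \<circ> r) n $ j) \<longlonglongrightarrow> h \<bullet> W $ j" using W(2) by (intro tendsto_intros)
    moreover have "h \<bullet> (V \<circ> r) n $ j = 1" for n using V_S by simp
    ultimately show ?thesis by (simp add: LIMSEQ_const_iff)
  qed
  have "x \<in> range (($) W)" if ext: "extreme_vector x (core A)" and hx: "h \<bullet> x = 1" for x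
  proof -
    have x: "x \<in> core A" using ext by (simp add: extreme_vector_def)
    let ?\<Delta> = "{l :: real^'n. (\<forall>i. 0 \<le> l $ i) \<and> (\<chi> i. 1) \<bullet> l = 1}"
    have "\<exists>l. l \<in> ?\<Delta> \<and> x = (\<Sum>j\<in>UNIV. l $ j *\<^sub>R V k $ j)" if k: "1 \<le> k" for k
    proof -
      obtain z where z: "\<forall>i. 0 \<le> z $ i" "x = pow k z"
        using x k unfolding mem_core_iff by blast
      have "z $ j *\<^sub>R pow k (axis j 1) = (\<chi> j. c k j * z $ j) $ j *\<^sub>R V k $ j" for j
        using c_pos [of k j] by (simp add: V_def)
      then have "x = (\<Sum>j\<in>UNIV. (\<chi> j. c k j * z $ j) $ j *\<^sub>R V k $ j)"
        unfolding z(2) expand [of k z] by (intro sum.cong) simp_all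
      moreover have "(\<Sum>j\<in>UNIV. c k j * z $ j) = 1"
        using hx z(2) weight [of k z] by (simp add: inner_vec_def)
      then have "(\<chi> j. c k j * z $ j) \<in> ?\<Delta>"
        using z(1) c_pos by (auto simp: inner_vec_def less_imp_le)
      ultimately show ?thesis by blast
    qed
    then have "\<forall>k\<in>{1..}. \<exists>l. l \<in> ?\<Delta> \<and> x = (\<Sum>j\<in>UNIV. l $ j *\<^sub>R V k $ j)" by simp
    from bchoice [OF this] obtain l
      where "\<forall>k\<in>{1..}. l k \<in> ?\<Delta> \<and> x = (\<Sum>j\<in>UNIV. l k $ j *\<^sub>R V k $ j)" ..
    then have l: "l k \<in> ?\<Delta>" "x = (\<Sum>j\<in>UNIV. l k $ j *\<^sub>R V k $ j)" if "1 \<le> k" for k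
      using that by (simp_all only: atLeast_iff)
    have compact: "compact ?\<Delta>" by (rule compact_weighted_simplex) simp
    \<comment> \<open>\<open>l\<close> is only specified at positive exponents and
      \<open>r 0\<close> may be 0, so the sequence is shifted by one.\<close>
    have r_pos: "1 \<le> r (Suc n)" for n using seq_suble [OF W(1), of "Suc n"] by simp
    then have "\<forall>n. l (r (Suc n)) \<in> ?\<Delta>" using l(1) by blast
    with compact_imp_seq_compact [OF compact] obtain L s
      where L: "L \<in> ?\<Delta>" "strict_mono s" "((\<lambda>n. l (r (Suc n))) \<circ> s) \<longlonglongrightarrow> L"
      by (rule seq_compactE)
    have Ws: "(\<lambda>n. V (r (Suc (s n)))) \<longlonglongrightarrow> W"
      using LIMSEQ_subseq_LIMSEQ [OF LIMSEQ_Suc [OF W(2)] L(2)] by (simp add: o_def)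
    have "(\<lambda>n. \<Sum>j\<in>UNIV. l (r (Suc (s n))) $ j *\<^sub>R V (r (Suc (s n))) $ j)
        \<longlonglongrightarrow> (\<Sum>j\<in>UNIV. L $ j *\<^sub>R W $ j)"
      using L(3) Ws by (intro tendsto_intros) (simp_all add: o_def)
    moreover have "(\<Sum>j\<in>UNIV. l (r (Suc (s n))) $ j *\<^sub>R V (r (Suc (s n))) $ j) = x" for n
      by (rule l(2) [OF r_pos, symmetric])
    ultimately have x_eq: "x = (\<Sum>j\<in>UNIV. L $ j *\<^sub>R W $ j)" by (simp add: LIMSEQ_const_iff)
    have "L \<noteq> 0" using L(1) by auto
    then have "\<exists>j. L $ j \<noteq> 0" by (simp add: vec_eq_iff)
    then obtain j where j: "0 < L $ j" using L(1) by (auto simp: order_less_le)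
    have summand: "L $ i *\<^sub>R W $ i \<in> core A" for i
      using W_core L(1) convex_cone_core [of A] unfolding convex_cone_iff by auto
    have "(\<Sum>i\<in>I. L $ i *\<^sub>R W $ i) \<in> core A" if "finite I" for I
      using that
    proof induction
      case empty
      show ?case using convex_cone_core [of A] by (simp add: convex_cone_iff)
    next
      case (insert i I)
      then show ?case using summand [of i] convex_cone_core [of A] by (simp add: convex_cone_iff)
    qed
    \<comment> \<open>The summand at \<open>j\<close> and the rest of the sum both lie in the core,
      so extremality makes the summand a multiple of \<open>x\<close>. Pairing with \<open>h\<close>
      then identifies \<open>x\<close> with \<open>W $ j\<close>.\<close>
    then have "x - L $ j *\<^sub>R W $ j \<in> core A"
      unfolding x_eq by (subst sum.remove [of UNIV j]) simp_all
    then obtain a where a: "L $ j *\<^sub>R W $ j = a *\<^sub>R x"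
      using ext summand unfolding extreme_vector_core_iff by blast
    from arg_cong [OF this, of "\<lambda>v. h \<bullet> v"] have "a = L $ j" using hx W_norm by simp
    with a j have "x = W $ j" by simp
    then show ?thesis by blast
  qed
  then show ?thesis
    by (intro finite_subset [OF _ finite_imageI [OF finite_class.finite_UNIV, of "($) W"]]) blast
qed

end

subsection \<open>Paths and cylinder sets\<close>

locale diagram =
  fixes B :: "('v, 'e) bratteli"
  assumes diagram: "bratteli_diagram B"
begin

definition tip :: "'e list \<Rightarrow> 'v" where
  "tip es = (if es = [] then root B else rng B (last es))"

definition out :: "nat \<Rightarrow> 'v \<Rightarrow> 'e set" where
  "out n v = {e \<in> edges B n. src B e = v}"

lemma finite_edges: "finite (edges B n)"
  and verts_0: "verts B 0 = {root B}"
  and rng_edges: "rng B ` edges B n = verts B (Suc n)"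
  and src_edges: "src B ` edges B n = verts B n"
  and disjoint_verts: "disjoint_family (verts B)"
  using diagram by (simp_all add: bratteli_diagram_def)

lemma rng_in_verts: "e \<in> edges B n \<Longrightarrow> rng B e \<in> verts B (Suc n)"
  using rng_edges by blast

lemma src_in_verts: "e \<in> edges B n \<Longrightarrow> src B e \<in> verts B n"
  using src_edges by blast

lemma level_unique: "v \<in> verts B m \<Longrightarrow> v \<in> verts B n \<Longrightarrow> m = n"
  using disjoint_verts unfolding disjoint_family_on_def by blast

lemma finite_out: "finite (out n v)"
  by (simp add: out_def finite_edges)

lemma out_nonempty: "v \<in> verts B n \<Longrightarrow> out n v \<noteq> {}"
  by (auto simp: out_def simp flip: src_edges)

lemma Nil_in_finite_paths: "[] \<in> finite_paths B"
  by (simp add: finite_paths_def)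

lemma tip_Nil: "tip [] = root B"
  and tip_snoc: "tip (es @ [e]) = rng B e"
  by (simp_all add: tip_def)

lemma paths_to_iff: "es \<in> paths_to B w \<longleftrightarrow> es \<in> finite_paths B \<and> tip es = w"
  by (simp add: paths_to_def tip_def)

lemma snoc_in_finite_paths:
  "es @ [e] \<in> finite_paths B \<longleftrightarrow> es \<in> finite_paths B \<and> e \<in> out (length es) (tip es)"
proof (cases es rule: rev_cases)
  case Nil
  have "src B e = root B" if "e \<in> edges B 0"
    using src_in_verts [OF that] verts_0 by simp
  then show ?thesis using Nil by (auto simp: finite_paths_def out_def tip_def)
next
  case (snoc us u)
  have "es @ [e] \<in> finite_paths B \<longleftrightarrow>
      (\<forall>i<length es. es ! i \<in> edges B i) \<and> e \<in> edges B (length es) \<and>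
      (\<forall>i. Suc i < length es \<longrightarrow> rng B (es ! i) = src B (es ! Suc i)) \<and>
      rng B (es ! (length es - 1)) = src B e"
    using snoc by (auto simp: finite_paths_def nth_append less_Suc_eq all_conj_distrib)
  moreover have "es ! (length es - 1) = u" using snoc by simp
  ultimately show ?thesis using snoc by (auto simp: finite_paths_def out_def tip_def)
qed

lemma tip_in_verts: "es \<in> finite_paths B \<Longrightarrow> tip es \<in> verts B (length es)"
  by (cases es rule: rev_cases)
    (auto simp: tip_Nil tip_snoc verts_0 snoc_in_finite_paths out_def rng_in_verts)

lemma length_eqI:
  "es \<in> finite_paths B \<Longrightarrow> es' \<in> finite_paths B \<Longrightarrow> tip es = tip es' \<Longrightarrow> length es = length es'"
  using tip_in_verts level_unique by metis

lemma path_to_vertex: "v \<in> verts B n \<Longrightarrow> \<exists>es\<in>finite_paths B. tip es = v \<and> length es = n"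
proof (induction n arbitrary: v)
  case 0
  then show ?case using Nil_in_finite_paths by (auto simp: verts_0 tip_Nil intro: bexI [of _ "[]"])
next
  case (Suc n)
  then obtain e where e: "e \<in> edges B n" "v = rng B e" using rng_edges by blast
  then obtain es where "es \<in> finite_paths B" "tip es = src B e" "length es = n"
    using Suc.IH src_in_verts by blast
  with e show ?case
    by (intro bexI [of _ "es @ [e]"]) (auto simp: snoc_in_finite_paths tip_snoc out_def)
qed

lemma countable_finite_paths: "countable (finite_paths B)"
proof (rule countable_subset)
  show "finite_paths B \<subseteq> lists (\<Union>n. edges B n)"
    by (fastforce simp: finite_paths_def in_lists_conv_set in_set_conv_nth)
  show "countable (lists (\<Union>n. edges B n))"
    using finite_edges by (intro countable_lists countable_UN) (auto intro: countable_finite)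
qed

definition prefix :: "nat \<Rightarrow> (nat \<Rightarrow> 'e) \<Rightarrow> 'e list" where
  "prefix n x = map x [0..<n]"

lemma length_prefix: "length (prefix n x) = n"
  and nth_prefix: "i < n \<Longrightarrow> prefix n x ! i = x i"
  by (simp_all add: prefix_def)

lemma prefix_Suc: "prefix (Suc n) x = prefix n x @ [x n]"
  by (simp add: prefix_def)

lemma prefix_path: "x \<in> inf_paths B \<Longrightarrow> prefix n x \<in> finite_paths B"
  by (auto simp: finite_paths_def inf_paths_def prefix_def)

lemma tip_prefix: "x \<in> inf_paths B \<Longrightarrow> tip (prefix n x) = src B (x n)"
  using prefix_path [of x "Suc n"] by (simp add: prefix_Suc snoc_in_finite_paths out_def)

lemma cylinder_subset: "cylinder B es \<subseteq> inf_paths B"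
  by (auto simp: cylinder_def)

lemma cylinder_Nil: "cylinder B [] = inf_paths B"
  by (auto simp: cylinder_def)

lemma mem_cylinder_iff:
  "x \<in> cylinder B es \<longleftrightarrow> x \<in> inf_paths B \<and> prefix (length es) x = es"
  by (auto simp: cylinder_def list_eq_iff_nth_eq length_prefix nth_prefix)

lemma take_prefix: "m \<le> n \<Longrightarrow> take m (prefix n x) = prefix m x"
  by (simp add: prefix_def take_map)

lemma cylinder_Int:
  assumes "length u \<le> length v"
  shows "cylinder B u \<inter> cylinder B v = (if take (length u) v = u then cylinder B v else {})"
  by (auto simp: mem_cylinder_iff take_prefix [OF assms, symmetric])

text \<open>Two cylinders are nested or disjoint; the empty set is added to cover the second
  case.\<close>

lemma Int_stable_cylinders: "Int_stable (insert {} (cylinder B ` finite_paths B))"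
proof -
  have "cylinder B u \<inter> cylinder B v \<in> insert {} (cylinder B ` finite_paths B)"
    if "u \<in> finite_paths B" "v \<in> finite_paths B" for u v
    using that cylinder_Int [of u v] cylinder_Int [of v u]
    by (cases "length u \<le> length v") (auto simp: Int_commute)
  then show ?thesis by (auto simp: Int_stable_def)
qed

lemma cylinder_split:
  assumes "es \<in> finite_paths B"
  shows "cylinder B es = (\<Union>e\<in>out (length es) (tip es). cylinder B (es @ [e]))"
proof
  show "cylinder B es \<subseteq> (\<Union>e\<in>out (length es) (tip es). cylinder B (es @ [e]))"
  proof
    fix x assume "x \<in> cylinder B es"
    then have x: "x \<in> inf_paths B" and es: "prefix (length es) x = es"
      by (auto simp: mem_cylinder_iff)
    have "prefix (Suc (length es)) x = es @ [x (length es)]" using es by (simp add: prefix_Suc)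
    moreover have "x (length es) \<in> out (length es) (tip es)"
      using prefix_path [OF x, of "Suc (length es)"] calculation
      by (simp add: snoc_in_finite_paths)
    ultimately show "x \<in> (\<Union>e\<in>out (length es) (tip es). cylinder B (es @ [e]))"
      using x by (auto simp: mem_cylinder_iff)
  qed
qed (auto simp: mem_cylinder_iff prefix_Suc)

lemma disjoint_cylinder_snoc: "disjoint_family_on (\<lambda>e. cylinder B (es @ [e])) I"
  by (auto simp: disjoint_family_on_def mem_cylinder_iff prefix_Suc)

lemma tower_1_eq:
  assumes "w \<in> verts B 1"
  shows "tower B 1 w = (\<Union>es\<in>paths_to B w. cylinder B es)"
proof
  show "tower B 1 w \<subseteq> (\<Union>es\<in>paths_to B w. cylinder B es)"
  proof
    fix x assume "x \<in> tower B 1 w"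
    then have "x \<in> inf_paths B" "rng B (x 0) = w" by (auto simp: tower_def)
    then show "x \<in> (\<Union>es\<in>paths_to B w. cylinder B es)"
      using prefix_path [of x 1]
      by (intro UN_I [of "prefix 1 x"])
        (auto simp: paths_to_iff mem_cylinder_iff length_prefix tip_def prefix_def)
  qed
  have "length es = 1" if "es \<in> paths_to B w" for es
    using that assms tip_in_verts level_unique unfolding paths_to_iff by blast
  then show "(\<Union>es\<in>paths_to B w. cylinder B es) \<subseteq> tower B 1 w"
    by (auto simp: tower_def mem_cylinder_iff paths_to_iff tip_def prefix_def)
qed

lemma paths_to_level_1:
  assumes "w \<in> verts B 1"
  shows "paths_to B w = (\<lambda>e. [e]) ` {e \<in> edges B 0. rng B e = w}"
proof -
  have "length es = 1" if "es \<in> paths_to B w" for es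
    using that assms tip_in_verts level_unique unfolding paths_to_iff by blast
  moreover have "[e] \<in> paths_to B w \<longleftrightarrow> e \<in> edges B 0 \<and> rng B e = w" for e
    by (auto simp: paths_to_def finite_paths_def)
  ultimately show ?thesis by (auto simp: length_Suc_conv)
qed

lemma height_level_1:
  assumes "w \<in> verts B 1"
  shows "height B w = card {e \<in> edges B 0. rng B e = w}"
  unfolding height_def paths_to_level_1 [OF assms] by (rule card_image) (simp add: inj_on_def)

subsection \<open>The Borel sets of the path space\<close>

text \<open>The topology is given by a subbase. The induction shows that cylinders form a base,
  since two cylinders through \<open>x\<close> contain the one of the longer prefix. The first
  conjunct keeps open sets inside the path space, as a sigma algebra on it requires.\<close>

lemma openin_path_topology_cylinder:
  assumes "openin (path_topology B) U" "x \<in> U"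
  shows "x \<in> inf_paths B \<and> (\<exists>n. cylinder B (prefix n x) \<subseteq> U)"
proof -
  have "generate_topology_on (cylinder B ` finite_paths B) U"
    using assms by (simp add: path_topology_def openin_topology_generated_by_iff)
  then show ?thesis using assms(2)
  proof (induction arbitrary: x)
    case (Int a b)
    then obtain m n where mn: "cylinder B (prefix m x) \<subseteq> a" "cylinder B (prefix n x) \<subseteq> b" by blast
    have "cylinder B (prefix (max m n) x) \<subseteq> cylinder B (prefix m x) \<inter> cylinder B (prefix n x)"
      by (auto simp: cylinder_def length_prefix nth_prefix)
    then show ?case using Int mn by blast
  next
    case (UN K)
    then show ?case by blast
  next
    case (Basis s)
    then obtain es where "s = cylinder B es" "x \<in> cylinder B es" by auto
    then show ?case by (metis mem_cylinder_iff order_refl)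
  qed simp
qed

lemma space_path_borel: "space (path_borel B) = inf_paths B"
  by (simp add: path_borel_def space_measure_of_conv)

text \<open>An open set is the union of the cylinders it contains, and there are only countably many
  finite paths.\<close>

lemma sets_path_borel: "sets (path_borel B) = sigma_sets (inf_paths B) (cylinder B ` finite_paths B)"
proof -
  have "{U. openin (path_topology B) U} \<subseteq> Pow (inf_paths B)"
    using openin_path_topology_cylinder by blast
  then have "sets (path_borel B) = sigma_sets (inf_paths B) {U. openin (path_topology B) U}"
    by (simp add: path_borel_def)
  also have "\<dots> = sigma_sets (inf_paths B) (cylinder B ` finite_paths B)"
  proof (rule sigma_sets_eqI)
    fix U assume "U \<in> {U. openin (path_topology B) U}"
    then have U: "openin (path_topology B) U" by simp
    let ?I = "{es \<in> finite_paths B. cylinder B es \<subseteq> U}"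
    have "U \<subseteq> (\<Union>es\<in>?I. cylinder B es)"
    proof
      fix x assume "x \<in> U"
      with openin_path_topology_cylinder [OF U] obtain n
        where "x \<in> inf_paths B" "cylinder B (prefix n x) \<subseteq> U" by blast
      then show "x \<in> (\<Union>es\<in>?I. cylinder B es)"
        by (intro UN_I [of "prefix n x"]) (auto simp: prefix_path mem_cylinder_iff length_prefix)
    qed
    then have "U = (\<Union>es\<in>?I. cylinder B es)" by blast
    also have "\<dots> \<in> sigma_sets (inf_paths B) (cylinder B ` finite_paths B)"
      by (rule sigma_sets_UNION)
        (auto intro!: countable_image countable_subset [OF _ countable_finite_paths]
          intro: sigma_sets.Basic)
    finally show "U \<in> sigma_sets (inf_paths B) (cylinder B ` finite_paths B)" .
  next
    fix C assume "C \<in> cylinder B ` finite_paths B"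
    then show "C \<in> sigma_sets (inf_paths B) {U. openin (path_topology B) U}"
      by (intro sigma_sets.Basic) (simp add: path_topology_def topology_generated_by_Basis)
  qed
  finally show ?thesis .
qed

lemma sets_path_borel':
  "sets (path_borel B) = sigma_sets (inf_paths B) (insert {} (cylinder B ` finite_paths B))"
  unfolding sets_path_borel by (rule sigma_sets_eqI) (auto intro: sigma_sets.intros)

lemma cylinder_sets: "es \<in> finite_paths B \<Longrightarrow> cylinder B es \<in> sets (path_borel B)"
  unfolding sets_path_borel by (intro sigma_sets.Basic) blast

text \<open>Dynkin's pi-lambda argument: as cylinders are stable under intersection, closure under
  disjoint countable unions suffices.\<close>

lemma path_borel_induct [consumes 1, case_names cylinder empty compl union]:
  assumes S: "S \<in> sets (path_borel B)"
    and "\<And>es. es \<in> finite_paths B \<Longrightarrow> P (cylinder B es)"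
    and "P {}"
    and "\<And>S. S \<in> sets (path_borel B) \<Longrightarrow> P S \<Longrightarrow> P (inf_paths B - S)"
    and "\<And>S. disjoint_family S \<Longrightarrow> range S \<subseteq> sets (path_borel B) \<Longrightarrow> (\<And>i. P (S i)) \<Longrightarrow>
      P (\<Union>i::nat. S i)"
  shows "P S"
  using Int_stable_cylinders _ S [unfolded sets_path_borel']
proof (rule sigma_sets_induct_disjoint)
  show "insert {} (cylinder B ` finite_paths B) \<subseteq> Pow (inf_paths B)"
    using cylinder_subset by blast
qed (use assms(2-) in \<open>auto simp flip: sets_path_borel'\<close>)

text \<open>Both sides are countably additive in \<open>S\<close> and agree on an
  intersection-stable generator that contains the whole space. The coefficients let it serve both
  uniqueness (\<open>a = 1\<close>, \<open>b = 0\<close>) and convex decompositions.\<close>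

lemma measure_linear_relation:
  assumes "finite_measure M1" "finite_measure M2" "finite_measure M3"
    and sets: "sets M1 = sets (path_borel B)" "sets M2 = sets (path_borel B)"
      "sets M3 = sets (path_borel B)"
    and cyl: "\<And>es. es \<in> finite_paths B \<Longrightarrow>
      a * measure M1 (cylinder B es) + b * measure M2 (cylinder B es) = measure M3 (cylinder B es)"
    and S: "S \<in> sets (path_borel B)"
  shows "a * measure M1 S + b * measure M2 S = measure M3 S"
  using S
proof (induction rule: path_borel_induct)
  case (compl S)
  have space: "space M = inf_paths B" if "sets M = sets (path_borel B)" for M
    using sets_eq_imp_space_eq [OF that] by (simp add: space_path_borel)
  have diff: "measure M (inf_paths B - S) = measure M (inf_paths B) - measure M S"
    if "finite_measure M" "sets M = sets (path_borel B)" for M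
    using finite_measure.finite_measure_compl [OF that(1), of S] that compl.hyps space by simp
  have "a * measure M1 (inf_paths B - S) + b * measure M2 (inf_paths B - S) =
      (a * measure M1 (inf_paths B) + b * measure M2 (inf_paths B)) -
      (a * measure M1 S + b * measure M2 S)"
    by (simp add: diff [OF assms(1) sets(1)] diff [OF assms(2) sets(2)] algebra_simps)
  also have "\<dots> = measure M3 (inf_paths B) - measure M3 S"
    using cyl [OF Nil_in_finite_paths] compl.IH by (simp add: cylinder_Nil)
  also have "\<dots> = measure M3 (inf_paths B - S)"
    using diff [OF assms(3) sets(3)] by simp
  finally show ?case .
next
  case (union S)
  have sums: "(\<lambda>i. measure M (S i)) sums measure M (\<Union>i. S i)"
    if "finite_measure M" "sets M = sets (path_borel B)" for M
    using finite_measure.finite_measure_UNION [OF that(1)] union.hyps that(2) by simp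
  have "(\<lambda>i. a * measure M1 (S i) + b * measure M2 (S i))
      sums (a * measure M1 (\<Union>i. S i) + b * measure M2 (\<Union>i. S i))"
    using assms(1,2) sets by (intro sums_add sums_mult sums)
  then show ?case
    using sums [OF assms(3) sets(3)] union.IH by (simp add: sums_unique2)
qed (simp_all add: cyl)

end

subsection \<open>The Markov measure of a harmonic weight\<close>

context diagram
begin

text \<open>\<open>P v\<close> is meant as the measure of any cylinder ending at \<open>v\<close>.
  The sum runs over edges rather than target vertices, so multiple edges count; it expresses
  additivity when a cylinder is split by its next edge.\<close>

definition harmonic :: "('v \<Rightarrow> real) \<Rightarrow> bool" where
  "harmonic P \<longleftrightarrow> P (root B) = 1 \<and>
    (\<forall>n. \<forall>v\<in>verts B n. 0 \<le> P v \<and> P v = (\<Sum>e\<in>out n v. P (rng B e)))"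

lemma finite_path_snocD:
  assumes "es @ [e] \<in> finite_paths B"
  shows "es \<in> finite_paths B" "src B e = tip es" "e \<in> edges B (length es)" "e \<notin> set es"
proof -
  show es: "es \<in> finite_paths B" "src B e = tip es" and e: "e \<in> edges B (length es)"
    using assms by (auto simp: snoc_in_finite_paths out_def)
  show "e \<notin> set es"
  proof
    assume "e \<in> set es"
    then obtain i where i: "i < length es" "e = es ! i" by (auto simp: in_set_conv_nth)
    then have "e \<in> edges B i" using es by (simp add: finite_paths_def)
    then have "i = length es" using e src_in_verts level_unique by blast
    then show False using i by simp
  qed
qed

text \<open>Different positions of a path lie on different levels, so a path leaves each vertex at
  most once. Hence a cylinder prescribes at most one choice per vertex, and the choices are
  independent.\<close>

lemma inj_on_src_path: "es \<in> finite_paths B \<Longrightarrow> inj_on (src B) (set es)"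
proof (rule inj_onI)
  fix e e' assume es: "es \<in> finite_paths B" and "e \<in> set es" "e' \<in> set es" and eq: "src B e = src B e'"
  then obtain i j where ij: "i < length es" "e = es ! i" "j < length es" "e' = es ! j"
    by (auto simp: in_set_conv_nth)
  then have "e \<in> edges B i" "e' \<in> edges B j" using es by (auto simp: finite_paths_def)
  then have "i = j" using eq src_in_verts level_unique by metis
  then show "e = e'" using ij by simp
qed

text \<open>
  Choose at every vertex, independently, an outgoing edge, with the transition probabilities
  given by \<open>P\<close>. Following these choices from the root gives a random infinite path.
\<close>

lemma harmonic_imp_invariant_prob:
  assumes "harmonic P"
  shows "\<exists>\<mu>\<in>invariant_probs B. \<forall>es\<in>finite_paths B. measure \<mu> (cylinder B es) = P (tip es)"
proof -
  have P_root: "P (root B) = 1"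
    and P_nonneg: "\<And>n v. v \<in> verts B n \<Longrightarrow> 0 \<le> P v"
    and P_sum: "\<And>n v. v \<in> verts B n \<Longrightarrow> P v = (\<Sum>e\<in>out n v. P (rng B e))"
    using assms unfolding harmonic_def by blast+
  \<comment> \<open>The product is taken over the whole vertex type; elements that are not vertices
    get a dummy one-point space.\<close>
  define E where "E v = (if \<exists>n. v \<in> verts B n then {e. \<exists>n. e \<in> out n v} else {undefined})" for v
  have E_eq: "E v = out n v" if v: "v \<in> verts B n" for v n
  proof -
    have "m = n" if "e \<in> out m v" for e m
      using that v src_in_verts level_unique unfolding out_def by blast
    then show ?thesis using v unfolding E_def by auto
  qed
  have E_fin: "finite (E v)" and E_ne: "E v \<noteq> {}" for v
    using E_eq finite_out out_nonempty unfolding E_def by (cases "\<exists>n. v \<in> verts B n"; force)+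
  \<comment> \<open>At a vertex of weight 0 the quotients would not sum to 1. The uniform
    distribution used instead is harmless, as such a vertex is reached with probability 0.\<close>
  define T where "T v e =
    (if (\<exists>n. v \<in> verts B n) \<and> P v \<noteq> 0 then P (rng B e) / P v else 1 / card (E v))" for v e
  have T_nonneg: "0 \<le> T v e" if e: "e \<in> E v" for v e
  proof (cases "\<exists>n. v \<in> verts B n")
    case True
    then obtain n where n: "v \<in> verts B n" ..
    then have "rng B e \<in> verts B (Suc n)" using e E_eq rng_in_verts by (auto simp: out_def)
    then show ?thesis using P_nonneg n by (simp add: T_def)
  qed (simp add: T_def)
  have T_sum: "(\<Sum>e\<in>E v. T v e) = 1" for v
  proof (cases "(\<exists>n. v \<in> verts B n) \<and> P v \<noteq> 0")
    case True
    then obtain n where n: "v \<in> verts B n" and "P v \<noteq> 0" by blast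
    then have "T v e = P (rng B e) / P v" for e by (auto simp: T_def)
    then have "(\<Sum>e\<in>E v. T v e) = (\<Sum>e\<in>out n v. P (rng B e)) / P v"
      using E_eq [OF n] by (simp add: sum_divide_distrib)
    then show ?thesis using P_sum [OF n] \<open>P v \<noteq> 0\<close> by simp
  next
    case False
    then have "T v e = 1 / card (E v)" for e unfolding T_def by meson
    then show ?thesis using E_fin E_ne by simp
  qed
  \<comment> \<open>If \<open>P\<close> vanishes at the source, harmonicity makes the nonnegative
    weights of all its successors vanish, so the identity holds whatever \<open>T\<close> is
    there.\<close>
  have P_T: "P (src B e) * T (src B e) e = P (rng B e)" if e: "e \<in> edges B n" for e n
  proof -
    let ?v = "src B e"
    have v: "?v \<in> verts B n" using e by (rule src_in_verts)
    show ?thesis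
    proof (cases "P ?v = 0")
      case True
      have "0 \<le> P (rng B e')" if "e' \<in> out n ?v" for e'
        using that P_nonneg rng_in_verts by (auto simp: out_def)
      then have "P (rng B e) = 0"
        using P_sum [OF v] True sum_nonneg_eq_0_iff [OF finite_out, of n ?v "\<lambda>e. P (rng B e)"] e
        by (auto simp: out_def)
      then show ?thesis using True by simp
    next
      case False
      then show ?thesis using v by (auto simp: T_def)
    qed
  qed
  have P_path: "(\<Prod>e\<in>set es. T (src B e) e) = P (tip es)" if "es \<in> finite_paths B" for es
    using that
  proof (induction es rule: rev_induct)
    case Nil
    then show ?case by (simp add: tip_Nil P_root)
  next
    case (snoc e es)
    note e = finite_path_snocD [OF snoc.prems]
    then show ?case using snoc.IH P_T [OF e(3)] by (simp add: tip_snoc mult.commute)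
  qed
  define M where "M v = point_measure (E v) (\<lambda>e. ennreal (T v e))" for v
  have M_prob: "prob_space (M v)" for v
    unfolding M_def
    using T_sum T_nonneg by (intro prob_space_point_measure E_fin) (auto simp: sum_ennreal)
  interpret M: product_prob_space M UNIV
    by (rule product_prob_spaceI) (rule M_prob)
  let ?\<Omega> = "PiM UNIV M"
  have \<omega>_E: "\<omega> v \<in> E v" if "\<omega> \<in> space ?\<Omega>" for \<omega> v
    using that by (auto simp: space_PiM M_def space_point_measure)
  define vtx where "vtx \<omega> n = ((\<lambda>v. rng B (\<omega> v)) ^^ n) (root B)" for \<omega> n
  define X where "X \<omega> n = \<omega> (vtx \<omega> n)" for \<omega> n
  have vtx_level: "vtx \<omega> n \<in> verts B n" if "\<omega> \<in> space ?\<Omega>" for \<omega> n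
  proof (induction n)
    case 0
    show ?case by (simp add: vtx_def verts_0)
  next
    case (Suc n)
    then have "\<omega> (vtx \<omega> n) \<in> out n (vtx \<omega> n)" using \<omega>_E [OF that] E_eq by blast
    then show ?case using rng_in_verts by (auto simp: vtx_def out_def)
  qed
  have X_out: "X \<omega> n \<in> out n (vtx \<omega> n)" if "\<omega> \<in> space ?\<Omega>" for \<omega> n
    using \<omega>_E [OF that, of "vtx \<omega> n"] E_eq [OF vtx_level [OF that, of n]] by (simp add: X_def)
  have X_path: "X \<omega> \<in> inf_paths B" if "\<omega> \<in> space ?\<Omega>" for \<omega>
    using X_out [OF that] by (auto simp: inf_paths_def out_def) (simp add: X_def vtx_def)
  have vtx_tip: "vtx \<omega> n = tip (prefix n (X \<omega>))" if "\<omega> \<in> space ?\<Omega>" for \<omega> n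
    using tip_prefix [OF X_path [OF that]] X_out [OF that] by (simp add: out_def)
  \<comment> \<open>The cylinder event as conditions on separate coordinates
    \<open>\<omega> v\<close>, in the shape that the product formula expects. For a path, each of
    the sets involved is a single edge.\<close>
  let ?Q = "\<lambda>es. {\<omega> \<in> space ?\<Omega>. \<forall>v\<in>src B ` set es. \<omega> v \<in> {e \<in> set es. src B e = v}}"
  have preimage: "X -` cylinder B es \<inter> space ?\<Omega> = ?Q es" if "es \<in> finite_paths B" for es
  proof -
    have "X -` cylinder B es \<inter> space ?\<Omega> = {\<omega> \<in> space ?\<Omega>. \<forall>e\<in>set es. \<omega> (src B e) = e}"
      using that
    proof (induction es rule: rev_induct)
      case Nil
      then show ?case using X_path by (auto simp: cylinder_Nil)
    next
      case (snoc e es)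
      note e = finite_path_snocD [OF snoc.prems]
      have "X -` cylinder B (es @ [e]) \<inter> space ?\<Omega> =
          (X -` cylinder B es \<inter> space ?\<Omega>) \<inter> {\<omega>. X \<omega> (length es) = e}"
        by (auto simp: mem_cylinder_iff prefix_Suc)
      \<comment> \<open>On the cylinder of \<open>es\<close> the walk stands at
        \<open>tip es\<close> after \<open>length es\<close> steps, so its next edge is the choice
        made there.\<close>
      also have "\<dots> = (X -` cylinder B es \<inter> space ?\<Omega>) \<inter> {\<omega>. \<omega> (tip es) = e}"
        using vtx_tip by (auto simp: mem_cylinder_iff X_def)
      also have "\<dots> = {\<omega> \<in> space ?\<Omega>. \<forall>e\<in>set (es @ [e]). \<omega> (src B e) = e}"
        unfolding snoc.IH [OF e(1)] using e(2) by auto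
      finally show ?case .
    qed
    also have "\<dots> = ?Q es"
      using inj_on_src_path [OF that] by (auto dest: inj_onD)
    finally show ?thesis .
  qed
  have single: "{f \<in> set es. src B f = src B e} = {e}" "e \<in> E (src B e)"
    if "es \<in> finite_paths B" "e \<in> set es" for es e
  proof -
    show "{f \<in> set es. src B f = src B e} = {e}"
      using inj_on_src_path [OF that(1)] that(2) by (auto dest: inj_onD)
    obtain i where "e \<in> edges B i"
      using \<open>e \<in> set es\<close> \<open>es \<in> finite_paths B\<close> by (auto simp: finite_paths_def in_set_conv_nth)
    then show "e \<in> E (src B e)" using E_eq [OF src_in_verts] by (simp add: out_def)
  qed
  have Q_sets: "?Q es \<in> sets ?\<Omega>"
    and Q_measure: "emeasure ?\<Omega> (?Q es) = ennreal (P (tip es))" if es: "es \<in> finite_paths B" for es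
  proof -
    have sets: "{e \<in> set es. src B e = v} \<in> sets (M v)" if "v \<in> src B ` set es" for v
      using single(2) [OF es] by (auto simp: M_def sets_point_measure)
    show "?Q es \<in> sets ?\<Omega>"
      using sets by (intro sets.sets_Collect_finite_All sets_Collect_single) auto
    have "emeasure ?\<Omega> (?Q es) = (\<Prod>v\<in>src B ` set es. emeasure (M v) {e \<in> set es. src B e = v})"
      using sets by (intro M.emeasure_PiM_Collect) auto
    also have "\<dots> = (\<Prod>e\<in>set es. emeasure (M (src B e)) {f \<in> set es. src B f = src B e})"
      using inj_on_src_path [OF es] by (simp add: prod.reindex)
    also have "\<dots> = (\<Prod>e\<in>set es. ennreal (T (src B e) e))"
      using single [OF es] E_fin
      by (intro prod.cong) (simp_all add: M_def emeasure_point_measure_finite)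
    also have "\<dots> = ennreal (P (tip es))"
      using single [OF es] T_nonneg P_path [OF es] by (subst prod_ennreal) auto
    finally show "emeasure ?\<Omega> (?Q es) = ennreal (P (tip es))" .
  qed
  have X_meas: "X \<in> measurable ?\<Omega> (path_borel B)"
    by (rule measurable_sigma_sets [OF sets_path_borel])
      (use cylinder_subset X_path preimage Q_sets in auto)
  define \<mu> where "\<mu> = distr ?\<Omega> (path_borel B) X"
  have cyl: "measure \<mu> (cylinder B es) = P (tip es)" if "es \<in> finite_paths B" for es
  proof -
    have "emeasure \<mu> (cylinder B es) = ennreal (P (tip es))"
      unfolding \<mu>_def
      unfolding emeasure_distr [OF X_meas cylinder_sets [OF that]] preimage [OF that]
      by (rule Q_measure [OF that])
    then show ?thesis using P_nonneg tip_in_verts [OF that] by (simp add: measure_def)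
  qed
  moreover have "\<mu> \<in> invariant_probs B"
    unfolding invariant_probs_def
    using M.prob_space_distr [OF X_meas]
    by (auto simp: \<mu>_def [symmetric] paths_to_iff cyl) (simp_all add: \<mu>_def space_path_borel)
  ultimately show ?thesis by blast
qed

end

subsection \<open>Invariant measures and tail equivalence\<close>

context diagram
begin

lemma invariant_probsD:
  assumes "\<mu> \<in> invariant_probs B"
  shows "prob_space \<mu>" "space \<mu> = inf_paths B" "sets \<mu> = sets (path_borel B)"
    and "\<And>es es'. es \<in> finite_paths B \<Longrightarrow> es' \<in> finite_paths B \<Longrightarrow> tip es = tip es' \<Longrightarrow>
      measure \<mu> (cylinder B es) = measure \<mu> (cylinder B es')"
proof -
  show "prob_space \<mu>" "space \<mu> = inf_paths B" "sets \<mu> = sets (path_borel B)"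
    using assms by (simp_all add: invariant_probs_def)
  fix es es' assume "es \<in> finite_paths B" "es' \<in> finite_paths B" "tip es = tip es'"
  then have "tip es \<in> verts B (length es)" "es \<in> paths_to B (tip es)" "es' \<in> paths_to B (tip es)"
    using tip_in_verts [of es] by (auto simp: paths_to_iff)
  then show "measure \<mu> (cylinder B es) = measure \<mu> (cylinder B es')"
    using assms unfolding invariant_probs_def by blast
qed

lemma invariant_probsI:
  assumes "prob_space \<mu>" "space \<mu> = inf_paths B" "sets \<mu> = sets (path_borel B)"
    and "\<And>es es'. es \<in> finite_paths B \<Longrightarrow> es' \<in> finite_paths B \<Longrightarrow> tip es = tip es' \<Longrightarrow>
      measure \<mu> (cylinder B es) = measure \<mu> (cylinder B es')"
  shows "\<mu> \<in> invariant_probs B"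
  using assms by (auto simp: invariant_probs_def paths_to_iff)

section \<open>Replacing the beginning of a path\<close>

definition splice :: "'e list \<Rightarrow> (nat \<Rightarrow> 'e) \<Rightarrow> nat \<Rightarrow> 'e" where
  "splice es x i = (if i < length es then es ! i else x i)"

lemma splice_prefix: "splice (prefix n x) x = x"
  by (auto simp: splice_def fun_eq_iff length_prefix nth_prefix)

lemma splice_splice: "length es = length es' \<Longrightarrow> splice es (splice es' x) = splice es x"
  by (auto simp: splice_def fun_eq_iff)

lemma append_in_finite_paths:
  assumes "es \<in> finite_paths B" "es' \<in> finite_paths B" "tip es = tip es'"
  shows "(es @ r \<in> finite_paths B \<longleftrightarrow> es' @ r \<in> finite_paths B) \<and> tip (es @ r) = tip (es' @ r)"
  using length_eqI [OF assms] assms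
  by (induction r rule: rev_induct)
    (simp_all add: snoc_in_finite_paths tip_snoc flip: append_assoc)

text \<open>Only the junction needs an argument: the discarded and the inserted beginning end at the
  same vertex, which is the source of the next edge of \<open>x\<close>.\<close>

lemma splice_in_cylinder:
  assumes es: "es \<in> finite_paths B" "es' \<in> finite_paths B" "tip es = tip es'"
    and x: "x \<in> cylinder B es"
  shows "splice es' x \<in> cylinder B es'"
proof -
  have path: "x \<in> inf_paths B" and pre: "prefix (length es) x = es"
    using x by (auto simp: mem_cylinder_iff)
  have len: "length es = length es'" by (rule length_eqI [OF es])
  have "tip es' = src B (x (length es'))" using tip_prefix [OF path, of "length es"] pre es len by simp
  moreover have "tip es' = rng B (es' ! i)" if "Suc i = length es'" for i
  proof -
    have "i = length es' - 1" using that by simp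
    then show ?thesis using that by (auto simp: tip_def last_conv_nth)
  qed
  ultimately have junction: "rng B (es' ! i) = src B (x (Suc i))" if "Suc i = length es'" for i
    using that by metis
  have "splice es' x i \<in> edges B i" for i
    using path es(2) by (auto simp: splice_def inf_paths_def finite_paths_def)
  moreover have "rng B (splice es' x i) = src B (splice es' x (Suc i))" for i
  proof -
    consider "Suc i < length es'" | "Suc i = length es'" | "length es' \<le> i" by linarith
    then show ?thesis
      by cases (use path es(2) junction in
        \<open>auto simp: splice_def inf_paths_def finite_paths_def\<close>)
  qed
  ultimately have "splice es' x \<in> inf_paths B" by (simp add: inf_paths_def)
  then show ?thesis by (auto simp: cylinder_def splice_def)
qed

lemma splice_in_path: "es \<in> finite_paths B \<Longrightarrow> es' \<in> finite_paths B \<Longrightarrow> tip es = tip es' \<Longrightarrow>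
    x \<in> cylinder B es \<Longrightarrow> splice es' x \<in> inf_paths B"
  using splice_in_cylinder cylinder_subset by blast

text \<open>Splicing pulls a cylinder back to a cylinder or to the empty set. If \<open>u\<close> is
  no longer than the inserted path, that path alone decides; otherwise \<open>u\<close> must
  continue it, and the remaining edges of \<open>u\<close> are required of \<open>x\<close>.\<close>

lemma splice_vimage_cylinder:
  assumes es: "es \<in> finite_paths B" "es' \<in> finite_paths B" "tip es = tip es'"
    and u: "u \<in> finite_paths B"
  shows "{x \<in> cylinder B es. splice es' x \<in> cylinder B u} =
    (if length u \<le> length es then if take (length u) es' = u then cylinder B es else {}
     else if take (length es) u = es' then cylinder B (es @ drop (length es) u) else {})"
proof -
  have len: "length es = length es'" by (rule length_eqI [OF es])
  have *: "splice es' x \<in> cylinder B u \<longleftrightarrow> (\<forall>i<length u. splice es' x i = u ! i)"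
    if "x \<in> cylinder B es" for x
    using splice_in_path [OF es that] by (simp add: cylinder_def)
  show ?thesis
  proof (cases "length u \<le> length es")
    case True
    then have "(\<forall>i<length u. splice es' x i = u ! i) \<longleftrightarrow> take (length u) es' = u" for x
      using len by (auto simp: list_eq_iff_nth_eq splice_def)
    then show ?thesis using * True by auto
  next
    case False
    show ?thesis
    proof (cases "take (length es) u = es'")
      case eq: True
      have u': "u = es' @ drop (length es) u" using eq by (metis append_take_drop_id)
      have nth: "u ! i = es' ! i" if "i < length es" for i using eq that by (metis nth_take)
      have iff: "x \<in> cylinder B es \<and> (\<forall>i<length u. splice es' x i = u ! i) \<longleftrightarrow>
          x \<in> cylinder B (es @ drop (length es) u)" for x
        using False len nth
        by (auto simp: cylinder_def splice_def nth_append)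
      have "{x \<in> cylinder B es. splice es' x \<in> cylinder B u} = cylinder B (es @ drop (length es) u)"
        using * iff by blast
      then show ?thesis by (simp add: False eq)
    next
      case neq: False
      have "\<not> (\<forall>i<length u. splice es' x i = u ! i)" for x
      proof
        assume nth: "\<forall>i<length u. splice es' x i = u ! i"
        have "take (length es) u = es'"
        proof (rule nth_equalityI)
          show "take (length es) u ! i = es' ! i" if "i < length (take (length es) u)" for i
            using that nth [rule_format, of i] len by (simp add: splice_def)
        qed (use False len in simp)
        then show False using neq by simp
      qed
      then show ?thesis using False neq * by auto
    qed
  qed
qed

lemma splice_vimage_sets:
  assumes es: "es \<in> finite_paths B" "es' \<in> finite_paths B" "tip es = tip es'"
    and S: "S \<in> sets (path_borel B)"
  shows "{x \<in> cylinder B es. splice es' x \<in> S} \<in> sets (path_borel B)"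
  using S
proof (induction rule: path_borel_induct)
  case (cylinder u)
  have "es @ drop (length es) u \<in> finite_paths B" if "take (length es) u = es'"
    using append_in_finite_paths [OF es, of "drop (length es) u"] cylinder that
    by (metis append_take_drop_id)
  then show ?case
    using es by (simp add: splice_vimage_cylinder [OF es cylinder] cylinder_sets)
next
  case (compl S)
  have "{x \<in> cylinder B es. splice es' x \<in> inf_paths B - S} =
      cylinder B es - {x \<in> cylinder B es. splice es' x \<in> S}"
    using splice_in_path [OF es] by auto
  then show ?case using compl es cylinder_sets by simp
next
  case (union S)
  have "{x \<in> cylinder B es. splice es' x \<in> (\<Union>i. S i)} =
      (\<Union>i. {x \<in> cylinder B es. splice es' x \<in> S i})" by auto
  then show ?case using union.IH by (simp add: sets.countable_UN)
qed simp

text \<open>Invariance, given only on cylinders, extends to Borel sets by induction. In the base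
  case, \<open>es\<close> and \<open>es'\<close> followed by the same edges end at the same
  vertex.\<close>

lemma splice_vimage_measure:
  assumes es: "es \<in> finite_paths B" "es' \<in> finite_paths B" "tip es = tip es'"
    and \<mu>: "\<mu> \<in> invariant_probs B" and S: "S \<in> sets (path_borel B)"
  shows "measure \<mu> {x \<in> cylinder B es. splice es' x \<in> S} = measure \<mu> (S \<inter> cylinder B es')"
proof -
  interpret prob_space \<mu> using invariant_probsD(1) [OF \<mu>] .
  note [simp] = invariant_probsD(2,3) [OF \<mu>]
  note sets = splice_vimage_sets [OF es]
  have len: "length es = length es'" by (rule length_eqI [OF es])
  show ?thesis
    using S
  proof (induction rule: path_borel_induct)
    case (cylinder u)
    show ?case
    proof (cases "length u \<le> length es")
      case True
      then have "cylinder B u \<inter> cylinder B es' = (if take (length u) es' = u then cylinder B es' else {})"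
        using len by (intro cylinder_Int) simp
      then show ?thesis
        using True invariant_probsD(4) [OF \<mu> es]
        by (simp add: splice_vimage_cylinder [OF es cylinder])
    next
      case False
      then have Int: "cylinder B u \<inter> cylinder B es' = (if take (length es) u = es' then cylinder B u else {})"
        using cylinder_Int [of es' u] len by (simp add: Int_commute)
      show ?thesis
      proof (cases "take (length es) u = es'")
        case eq: True
        then have "es' @ drop (length es) u = u" by (metis append_take_drop_id)
        then have "es @ drop (length es) u \<in> finite_paths B" "tip (es @ drop (length es) u) = tip u"
          using append_in_finite_paths [OF es, of "drop (length es) u"] cylinder by simp_all
        then have "measure \<mu> (cylinder B (es @ drop (length es) u)) = measure \<mu> (cylinder B u)"
          by (intro invariant_probsD(4) [OF \<mu>] cylinder)
        then show ?thesis
          using False eq by (simp add: splice_vimage_cylinder [OF es cylinder] Int)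
      qed (use False in \<open>simp add: splice_vimage_cylinder [OF es cylinder] Int\<close>)
    qed
  next
    case (compl S)
    let ?S = "{x \<in> cylinder B es. splice es' x \<in> S}"
    have "{x \<in> cylinder B es. splice es' x \<in> inf_paths B - S} = cylinder B es - ?S"
      using splice_in_path [OF es] by auto
    moreover have "measure \<mu> (cylinder B es - ?S) = measure \<mu> (cylinder B es) - measure \<mu> ?S"
      using sets [OF compl.hyps] es by (intro finite_measure_Diff) (auto simp: cylinder_sets)
    moreover have "(inf_paths B - S) \<inter> cylinder B es' = cylinder B es' - S \<inter> cylinder B es'"
      using cylinder_subset by auto
    moreover have "measure \<mu> (cylinder B es' - S \<inter> cylinder B es') =
        measure \<mu> (cylinder B es') - measure \<mu> (S \<inter> cylinder B es')"
      using compl.hyps es by (intro finite_measure_Diff) (auto simp: cylinder_sets)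
    ultimately show ?case using compl.IH invariant_probsD(4) [OF \<mu> es] by simp
  next
    case (union S)
    let ?S = "\<lambda>i. {x \<in> cylinder B es. splice es' x \<in> S i}"
    have S: "S i \<in> sets (path_borel B)" for i using union.hyps by blast
    have "(\<lambda>i. measure \<mu> (?S i)) sums measure \<mu> (\<Union>i. ?S i)"
      using sets [OF S] union.hyps by (intro finite_measure_UNION) (auto simp: disjoint_family_on_def)
    moreover have "(\<lambda>i. measure \<mu> (S i \<inter> cylinder B es')) sums measure \<mu> (\<Union>i. S i \<inter> cylinder B es')"
      using S union.hyps cylinder_sets [OF es(2)]
      by (intro finite_measure_UNION) (auto simp: disjoint_family_on_def)
    ultimately have "measure \<mu> (\<Union>i. ?S i) = measure \<mu> (\<Union>i. S i \<inter> cylinder B es')"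
      using union.IH by (simp add: sums_unique2)
    moreover have "{x \<in> cylinder B es. splice es' x \<in> (\<Union>i. S i)} = (\<Union>i. ?S i)" by auto
    moreover have "(\<Union>i. S i) \<inter> cylinder B es' = (\<Union>i. S i \<inter> cylinder B es')" by blast
    ultimately show ?case by (simp only:)
  qed simp
qed

section \<open>Tail equivalence through countably many involutions\<close>

definition parallel :: "('e list \<times> 'e list) set" where
  "parallel = {(es, es'). es \<in> finite_paths B \<and> es' \<in> finite_paths B \<and> tip es = tip es'}"

text \<open>Made to be an involution of the path space, which \<open>splice\<close> alone is not.
  Distinct paths with a common end have equal length and hence disjoint cylinders, so on
  \<open>parallel\<close> the order of the tests is immaterial; for two equal paths the map is the
  identity.\<close>

definition swap :: "'e list \<times> 'e list \<Rightarrow> (nat \<Rightarrow> 'e) \<Rightarrow> nat \<Rightarrow> 'e" where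
  "swap = (\<lambda>(es, es') x.
    if x \<in> cylinder B es then splice es' x else if x \<in> cylinder B es' then splice es x else x)"

lemma countable_parallel: "countable parallel"
  unfolding parallel_def
  by (rule countable_subset [OF _ countable_SIGMA [OF countable_finite_paths countable_finite_paths]])
    auto

lemma swap_in_path: "d \<in> parallel \<Longrightarrow> x \<in> inf_paths B \<Longrightarrow> swap d x \<in> inf_paths B"
  using splice_in_path unfolding parallel_def swap_def by auto

lemma swap_swap:
  assumes "d \<in> parallel" "x \<in> inf_paths B"
  shows "swap d (swap d x) = x"
proof -
  obtain es es' where d: "d = (es, es')" and es: "es \<in> finite_paths B" "es' \<in> finite_paths B" "tip es = tip es'"
    using assms(1) by (auto simp: parallel_def)
  have len: "length es = length es'" by (rule length_eqI [OF es])
  have splice: "splice es x = x" if "x \<in> cylinder B es" for es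
    using that splice_prefix by (metis mem_cylinder_iff)
  have disj: "y \<notin> cylinder B es" if "y \<in> cylinder B es'" "es \<noteq> es'" for y
    using that len by (auto simp: mem_cylinder_iff)
  show ?thesis
  proof (cases "es = es'")
    case True
    then show ?thesis using splice by (simp add: d swap_def)
  next
    case False
    then show ?thesis
      using splice_in_cylinder [OF es, of x] splice_in_cylinder [of es' es x] es disj splice len
      by (auto simp: d swap_def splice_splice)
  qed
qed

lemma tail_equiv_swap: "d \<in> parallel \<Longrightarrow> x \<in> inf_paths B \<Longrightarrow> (x, swap d x) \<in> tail_equiv B"
proof -
  assume d: "d \<in> parallel" and x: "x \<in> inf_paths B"
  have "\<forall>i\<ge>max (length (fst d)) (length (snd d)). x i = swap d x i"
    by (auto simp: swap_def splice_def split: prod.splits)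
  then show "(x, swap d x) \<in> tail_equiv B"
    using swap_in_path [OF d x] x unfolding tail_equiv_def by blast
qed

text \<open>The prefixes are cut off at an index from which the paths agree. Both end at the source
  of the common next edge, so exchanging them carries \<open>x\<close> to \<open>y\<close>.\<close>

lemma tail_equiv_imp_swap:
  assumes "(x, y) \<in> tail_equiv B"
  shows "\<exists>d\<in>parallel. y = swap d x"
proof -
  obtain n where x: "x \<in> inf_paths B" and y: "y \<in> inf_paths B" and n: "\<forall>i\<ge>n. x i = y i"
    using assms by (auto simp: tail_equiv_def)
  let ?d = "(prefix n x, prefix n y)"
  have "?d \<in> parallel"
    using tip_prefix [OF x, of n] tip_prefix [OF y, of n] n prefix_path [OF x] prefix_path [OF y]
    by (simp add: parallel_def)
  moreover have "swap ?d x = y"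
    using x n by (auto simp: swap_def mem_cylinder_iff length_prefix splice_def nth_prefix fun_eq_iff)
  ultimately show ?thesis by (intro bexI [of _ ?d]) simp_all
qed

lemma tail_equiv_sym: "(x, y) \<in> tail_equiv B \<Longrightarrow> (y, x) \<in> tail_equiv B"
  by (auto simp: tail_equiv_def) (metis)

lemma tail_equiv_trans: "(x, y) \<in> tail_equiv B \<Longrightarrow> (y, z) \<in> tail_equiv B \<Longrightarrow> (x, z) \<in> tail_equiv B"
  by (auto simp: tail_equiv_def) (metis le_trans nat_le_linear)

text \<open>The preimage has a part in each of the two cylinders, which splicing moves, and a part
  outside, which is fixed. Equal paths are treated apart, because then the first two parts coincide
  and must not be counted twice.\<close>

lemma swap_vimage:
  assumes d: "d \<in> parallel" and S: "S \<in> sets (path_borel B)"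
  shows "swap d -` S \<inter> inf_paths B \<in> sets (path_borel B)"
    and "\<mu> \<in> invariant_probs B \<Longrightarrow> measure \<mu> (swap d -` S \<inter> inf_paths B) = measure \<mu> S"
proof -
  obtain es es' where d: "d = (es, es')" and es: "es \<in> finite_paths B" "es' \<in> finite_paths B" "tip es = tip es'"
    using d by (auto simp: parallel_def)
  note es' = es(2,1) es(3) [symmetric]
  have len: "length es = length es'" by (rule length_eqI [OF es])
  have S_sub: "S \<subseteq> inf_paths B" using S sets.sets_into_space space_path_borel by metis
  have splice: "splice es x = x" if "x \<in> cylinder B es" for es x
    using that splice_prefix by (metis mem_cylinder_iff)
  have swap_id: "swap d x = x" if "es = es'" for x using that splice by (simp add: d swap_def)
  let ?V = "{x \<in> cylinder B es. splice es' x \<in> S}"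
  let ?W = "{x \<in> cylinder B es'. splice es x \<in> S}"
  let ?R = "S - (cylinder B es \<union> cylinder B es')"
  have eq: "swap d -` S \<inter> inf_paths B = (?V \<union> ?W) \<union> ?R"
  proof (cases "es = es'")
    case True
    have "?V = S \<inter> cylinder B es" "?W = S \<inter> cylinder B es" using True splice by auto
    moreover have "swap d -` S \<inter> inf_paths B = S" using swap_id [OF True] S_sub by auto
    ultimately show ?thesis using True by blast
  next
    case False
    have "x \<notin> cylinder B es" if "x \<in> cylinder B es'" for x
      using that len False by (auto simp: mem_cylinder_iff)
    then show ?thesis using S_sub cylinder_subset by (auto simp: d swap_def split: if_splits)
  qed
  have R: "?R \<in> sets (path_borel B)" using S es cylinder_sets by auto
  have VW: "?V \<in> sets (path_borel B)" "?W \<in> sets (path_borel B)"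
    by (rule splice_vimage_sets [OF es S] splice_vimage_sets [OF es' S])+
  then show "swap d -` S \<inter> inf_paths B \<in> sets (path_borel B)"
    unfolding eq using R by blast
  show "measure \<mu> (swap d -` S \<inter> inf_paths B) = measure \<mu> S" if \<mu>: "\<mu> \<in> invariant_probs B"
  proof (cases "es = es'")
    case True
    then have "swap d -` S \<inter> inf_paths B = S"
      using swap_id S_sub by auto
    then show ?thesis by simp
  next
    case False
    interpret prob_space \<mu> using invariant_probsD(1) [OF \<mu>] .
    note [simp] = invariant_probsD(2,3) [OF \<mu>]
    have disj: "cylinder B es \<inter> cylinder B es' = {}"
      using len False by (auto simp: mem_cylinder_iff)
    have sets: "S \<inter> cylinder B es \<in> events" "S \<inter> cylinder B es' \<in> events"
      using S es cylinder_sets by auto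
    have "measure \<mu> (swap d -` S \<inter> inf_paths B) = measure \<mu> ?V + measure \<mu> ?W + measure \<mu> ?R"
      unfolding eq using VW R disj by (subst finite_measure_Union; (subst finite_measure_Union)?) auto
    also have "\<dots> = measure \<mu> (S \<inter> cylinder B es') + measure \<mu> (S \<inter> cylinder B es) + measure \<mu> ?R"
      using splice_vimage_measure [OF es \<mu> S] splice_vimage_measure [OF es' \<mu> S] by simp
    also have "\<dots> = measure \<mu> ((S \<inter> cylinder B es' \<union> S \<inter> cylinder B es) \<union> ?R)"
      using sets R disj by (subst finite_measure_Union; (subst finite_measure_Union)?) auto
    also have "(S \<inter> cylinder B es' \<union> S \<inter> cylinder B es) \<union> ?R = S" by blast
    finally show ?thesis .
  qed
qed

end

subsection \<open>Ergodicity\<close>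

context diagram
begin

lemma distr_swap:
  assumes d: "d \<in> parallel" and \<mu>: "\<mu> \<in> invariant_probs B"
  shows "swap d \<in> measurable \<mu> \<mu>" "distr \<mu> \<mu> (swap d) = \<mu>"
proof -
  interpret prob_space \<mu> using invariant_probsD(1) [OF \<mu>] .
  note [simp] = invariant_probsD(2,3) [OF \<mu>]
  show meas: "swap d \<in> measurable \<mu> \<mu>"
    using swap_in_path [OF d] swap_vimage(1) [OF d] by (auto simp: measurable_def)
  show "distr \<mu> \<mu> (swap d) = \<mu>"
  proof (rule measure_eqI)
    fix S assume "S \<in> sets (distr \<mu> \<mu> (swap d))"
    then have S: "S \<in> sets (path_borel B)" by simp
    then show "emeasure (distr \<mu> \<mu> (swap d)) S = emeasure \<mu> S"
      using swap_vimage(2) [OF d S \<mu>] meas by (simp add: emeasure_distr emeasure_eq_measure)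
  qed simp
qed

text \<open>A saturated set contains \<open>x\<close> exactly when it contains the spliced path. So
  splicing carries \<open>S\<close> within one cylinder to \<open>S\<close> within the other, and
  conditioning on \<open>S\<close> preserves invariance.\<close>

lemma saturated_restriction:
  assumes \<mu>: "\<mu> \<in> invariant_probs B" and S: "S \<in> sets (path_borel B)"
    and sat: "tail_equiv B `` S \<subseteq> S" and pos: "measure \<mu> S \<noteq> 0"
  shows "uniform_measure \<mu> S \<in> invariant_probs B"
    and "T \<in> sets (path_borel B) \<Longrightarrow> measure (uniform_measure \<mu> S) T = measure \<mu> (S \<inter> T) / measure \<mu> S"
proof -
  interpret prob_space \<mu> using invariant_probsD(1) [OF \<mu>] .
  note [simp] = invariant_probsD(2,3) [OF \<mu>]
  have ne: "emeasure \<mu> S \<noteq> 0" "emeasure \<mu> S \<noteq> \<infinity>"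
    using pos by (auto simp: emeasure_eq_measure)
  show val: "measure (uniform_measure \<mu> S) T = measure \<mu> (S \<inter> T) / measure \<mu> S"
    if "T \<in> sets (path_borel B)" for T
    using that by (intro measure_uniform_measure ne) simp
  show "uniform_measure \<mu> S \<in> invariant_probs B"
  proof (rule invariant_probsI)
    show "prob_space (uniform_measure \<mu> S)" by (rule prob_space_uniform_measure [OF ne])
    fix es es' assume es: "es \<in> finite_paths B" "es' \<in> finite_paths B" "tip es = tip es'"
    have "splice es' x \<in> S \<longleftrightarrow> x \<in> S" if x: "x \<in> cylinder B es" for x
    proof -
      have "(x, splice es' x) \<in> tail_equiv B"
        using tail_equiv_swap [of "(es, es')" x] x es cylinder_subset
        by (auto simp: parallel_def swap_def)
      then show ?thesis using sat tail_equiv_sym by blast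
    qed
    then have "{x \<in> cylinder B es. splice es' x \<in> S} = S \<inter> cylinder B es" by blast
    then have "measure \<mu> (S \<inter> cylinder B es) = measure \<mu> (S \<inter> cylinder B es')"
      using splice_vimage_measure [OF es \<mu> S] by simp
    then show "measure (uniform_measure \<mu> S) (cylinder B es) =
        measure (uniform_measure \<mu> S) (cylinder B es')"
      using es by (simp add: val cylinder_sets)
  qed simp_all
qed

text \<open>
  The density \<open>f\<close> of \<open>\<nu>\<close> is a.e. invariant under every swap. Its supremum \<open>g\<close> over the orbit is
  invariant everywhere, and the set where \<open>g\<close> exceeds \<open>1\<close> distinguishes the two measures.
\<close>

lemma saturated_set_distinguishes:
  assumes \<mu>: "\<mu> \<in> invariant_probs B" and \<nu>: "\<nu> \<in> invariant_probs B"
    and ac: "absolutely_continuous \<mu> \<nu>" and ne: "\<nu> \<noteq> \<mu>"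
  shows "\<exists>S\<in>sets (path_borel B). tail_equiv B `` S \<subseteq> S \<and> measure \<nu> S \<noteq> measure \<mu> S"
proof -
  interpret M: prob_space \<mu> using invariant_probsD(1) [OF \<mu>] .
  interpret N: prob_space \<nu> using invariant_probsD(1) [OF \<nu>] .
  have sets_N: "sets \<nu> = sets \<mu>" and sets_M: "sets \<mu> = sets (path_borel B)"
    and space_M: "space \<mu> = inf_paths B"
    using invariant_probsD [OF \<mu>] invariant_probsD [OF \<nu>] by simp_all
  define f where "f = RN_deriv \<mu> \<nu>"
  have f [measurable]: "f \<in> borel_measurable \<mu>" by (simp add: f_def)
  have dens: "density \<mu> f = \<nu>" unfolding f_def by (rule M.density_RN_deriv [OF ac sets_N])
  have f_swap: "AE x in \<mu>. f (swap d x) = f x" if d: "d \<in> parallel" for d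
  proof -
    note swap = distr_swap [OF d \<mu>]
    \<comment> \<open>The swap is its own inverse and preserves both measures, so \<open>f\<close>
      composed with it is again a density of \<open>\<nu>\<close>; densities are unique almost
      everywhere.\<close>
    have "density \<mu> (f \<circ> swap d) = distr (density (distr \<mu> \<mu> (swap d)) f) \<mu> (swap d)"
      using swap(1) swap_swap [OF d] by (intro distr_density_distr [symmetric]) (auto simp: space_M)
    also have "\<dots> = distr \<nu> \<nu> (swap d)" by (simp add: swap dens sets_N cong: distr_cong)
    also have "\<dots> = density \<mu> f" using distr_swap(2) [OF d \<nu>] dens by simp
    finally show ?thesis
      using swap(1) by (intro M.density_unique) (simp_all add: o_def)
  qed
  define g where "g x = (SUP d\<in>parallel. f (swap d x))" for x
  have g [measurable]: "g \<in> borel_measurable \<mu>"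
    unfolding g_def
    by (intro borel_measurable_SUP countable_parallel measurable_compose [OF distr_swap(1) [OF _ \<mu>] f])
  have "([], []) \<in> parallel" by (simp add: parallel_def Nil_in_finite_paths)
  \<comment> \<open>A constant family has its constant as supremum only over a nonempty index
    set.\<close>
  then have "parallel \<noteq> {}" by blast
  have g_f: "AE x in \<mu>. g x = f x"
  proof -
    have "AE x in \<mu>. \<forall>d\<in>parallel. f (swap d x) = f x"
      using f_swap countable_parallel by (simp add: AE_ball_countable)
    then show ?thesis
      by eventually_elim (use \<open>parallel \<noteq> {}\<close> in \<open>simp add: g_def\<close>)
  qed
  define S where "S = {x \<in> space \<mu>. 1 < g x}"
  have S: "S \<in> sets \<mu>" unfolding S_def by measurable
  have sat: "tail_equiv B `` S \<subseteq> S"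
  proof safe
    fix x y assume xy: "(x, y) \<in> tail_equiv B" and "x \<in> S"
    then have x: "x \<in> inf_paths B" and y: "y \<in> inf_paths B" by (auto simp: tail_equiv_def)
    \<comment> \<open>The swap images of a path exhaust its tail class, so those of \<open>x\<close>
      are among those of \<open>y\<close>.\<close>
    have "g x \<le> g y"
      unfolding g_def
    proof (rule SUP_least)
      fix d assume "d \<in> parallel"
      then have "(y, swap d x) \<in> tail_equiv B"
        using tail_equiv_swap x tail_equiv_sym [OF xy] tail_equiv_trans by blast
      then obtain d' where "d' \<in> parallel" "swap d x = swap d' y" using tail_equiv_imp_swap by blast
      then show "f (swap d x) \<le> (SUP d\<in>parallel. f (swap d y))"
        using SUP_upper [of d' parallel "\<lambda>d. f (swap d y)"] by simp
    qed
    then show "y \<in> S" using \<open>x \<in> S\<close> y by (auto simp: S_def space_M)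
  qed
  \<comment> \<open>Equality would make \<open>f - 1\<close>, positive almost everywhere on
    \<open>S\<close>, integrate to 0 over \<open>S\<close>, so \<open>S\<close> would be null. Then
    \<open>f\<close> is at most 1 almost everywhere with integral 1, so \<open>f = 1\<close> almost
    everywhere and \<open>\<nu> = \<mu>\<close>. Subtraction in \<open>ennreal\<close> is truncated,
    hence the bounds \<open>ge\<close> and \<open>le\<close> beforehand.\<close>
  have "measure \<nu> S \<noteq> measure \<mu> S"
  proof
    assume eq: "measure \<nu> S = measure \<mu> S"
    have ge: "AE x in \<mu>. indicator S x \<le> f x * indicator S x"
      using g_f by eventually_elim (auto simp: S_def indicator_def)
    have int_S: "(\<integral>\<^sup>+ x. f x * indicator S x \<partial>\<mu>) = (\<integral>\<^sup>+ x. indicator S x \<partial>\<mu>)"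
      using emeasure_density [OF f S] S eq
      by (simp add: dens N.emeasure_eq_measure M.emeasure_eq_measure)
    have "(\<integral>\<^sup>+ x. f x * indicator S x - indicator S x \<partial>\<mu>) = 0"
      using S ge by (subst nn_integral_diff) (auto simp: int_S M.emeasure_eq_measure)
    then have "AE x in \<mu>. f x * indicator S x - indicator S x = 0"
      using S by (subst (asm) nn_integral_0_iff_AE) auto
    then have "AE x in \<mu>. x \<notin> S"
      using g_f
    proof eventually_elim
      case (elim x)
      then show ?case by (auto simp: S_def indicator_def diff_eq_0_iff_ennreal)
    qed
    then have le: "AE x in \<mu>. f x \<le> 1"
      using g_f AE_space by eventually_elim (auto simp: S_def)
    have int_1: "(\<integral>\<^sup>+ x. f x \<partial>\<mu>) = 1"
      using emeasure_density [OF f sets.top] N.emeasure_space_1 sets_eq_imp_space_eq [OF sets_N]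
      by (simp add: dens cong: nn_integral_cong)
    have "(\<integral>\<^sup>+ x. 1 - f x \<partial>\<mu>) = 0"
      using le by (subst nn_integral_diff) (auto simp: int_1 M.emeasure_space_1)
    then have "AE x in \<mu>. 1 - f x = 0" by (subst (asm) nn_integral_0_iff_AE) auto
    then have "AE x in \<mu>. f x = 1"
      using le by eventually_elim (auto simp: diff_eq_0_iff_ennreal)
    then have "density \<mu> f = density \<mu> (\<lambda>_. 1)" by (intro density_cong) auto
    then show False using ne dens by (simp add: density_1)
  qed
  then show ?thesis using S sat sets_M by auto
qed

text \<open>Ergodicity gives a saturated set measure 0 or 1, and absolute continuity passes this
  value on to \<open>\<nu>\<close>, so no saturated set can distinguish the two measures.\<close>

lemma ergodic_unique:
  assumes \<mu>: "\<mu> \<in> invariant_probs B" and erg: "ergodic B \<mu>" and \<nu>: "\<nu> \<in> invariant_probs B"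
    and ac: "absolutely_continuous \<mu> \<nu>"
  shows "\<nu> = \<mu>"
proof (rule ccontr)
  assume "\<nu> \<noteq> \<mu>"
  then obtain S where S: "S \<in> sets (path_borel B)" "tail_equiv B `` S \<subseteq> S"
    and ne: "measure \<nu> S \<noteq> measure \<mu> S"
    using saturated_set_distinguishes [OF \<mu> \<nu> ac] by blast
  interpret M: prob_space \<mu> using invariant_probsD(1) [OF \<mu>] .
  interpret N: prob_space \<nu> using invariant_probsD(1) [OF \<nu>] .
  have sets: "S \<in> sets \<mu>" "S \<in> sets \<nu>" and spaces: "space \<nu> = space \<mu>"
    using S invariant_probsD [OF \<mu>] invariant_probsD [OF \<nu>] by simp_all
  have null: "measure \<nu> T = 0" if "measure \<mu> T = 0" "T \<in> sets \<mu>" for T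
  proof -
    have "T \<in> null_sets \<mu>" using that by (simp add: null_sets_def M.emeasure_eq_measure)
    then have "T \<in> null_sets \<nu>" using ac by (auto simp: absolutely_continuous_def)
    then show ?thesis by (simp add: null_sets_def measure_def)
  qed
  have "measure \<mu> S = 0 \<or> measure \<mu> (space \<mu> - S) = 0"
    using erg S sets by (simp add: ergodic_def)
  then show False
  proof
    assume "measure \<mu> S = 0"
    then show False using null sets ne by simp
  next
    assume *: "measure \<mu> (space \<mu> - S) = 0"
    then have "measure \<nu> (space \<mu> - S) = 0" using null sets by auto
    then show False
      using * ne M.prob_compl [OF sets(1)] N.prob_compl [OF sets(2)] spaces by simp
  qed
qed

end

subsection \<open>Stationary diagrams\<close>

locale stationary_diagram = diagram B for B :: "('v, 'e) bratteli" +
  fixes lab :: "nat \<Rightarrow> 'n::finite \<Rightarrow> 'v" and F :: "nat^'n^'n"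
  assumes stationary: "stationary B lab F"
begin

definition mat_A :: "real^'n^'n" where
  "mat_A = transpose (map_matrix real F)"

definition hvec :: "real^'n" where
  "hvec = (\<chi> w. real (height B (lab 1 w)))"

lemma lab_bij: "1 \<le> n \<Longrightarrow> bij_betw (lab n) UNIV (verts B n)"
  and incidence_eq: "1 \<le> n \<Longrightarrow> incidence B n (lab (Suc n) i) (lab n j) = F $ i $ j"
  using stationary by (simp_all add: stationary_def)

lemma lab_in_verts: "1 \<le> n \<Longrightarrow> lab n i \<in> verts B n"
  using lab_bij bij_betwE by blast

lemma mat_A_nth: "mat_A $ i $ j = real (F $ j $ i)"
  by (simp add: mat_A_def transpose_def map_matrix_def)

sublocale nonneg_matrix mat_A
proof
  fix i j :: 'n
  show "0 \<le> mat_A $ i $ j" by (simp add: mat_A_nth)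
next
  fix j :: 'n
  \<comment> \<open>Level 2 is the first one whose incoming edges are described by
    \<open>F\<close>.\<close>
  have "lab 2 j \<in> rng B ` edges B 1"
    using rng_edges [of 1] lab_in_verts [of 2 j] by (simp add: numeral_2_eq_2)
  then obtain e where e: "e \<in> edges B 1" "rng B e = lab 2 j" by force
  then have "src B e \<in> verts B 1" by (simp add: src_in_verts)
  then obtain i where i: "src B e = lab 1 i" using lab_bij [of 1] by (auto simp: bij_betw_def)
  have "e \<in> {e \<in> edges B 1. rng B e = lab 2 j \<and> src B e = lab 1 i}" using e i by simp
  then have "0 < incidence B 1 (lab 2 j) (lab 1 i)"
    unfolding incidence_def using finite_edges by (subst card_gt_0_iff) auto
  then have "0 < mat_A $ i $ j" using incidence_eq [of 1 j i] by (simp add: mat_A_nth numeral_2_eq_2)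
  then show "\<exists>i. 0 < mat_A $ i $ j" ..
qed

lemma sum_out:
  "(\<Sum>e\<in>out n v. g (rng B e)) =
    (\<Sum>i\<in>UNIV. real (card {e \<in> out n v. rng B e = lab (Suc n) i}) * g (lab (Suc n) i))"
proof -
  have bij: "bij_betw (lab (Suc n)) UNIV (verts B (Suc n))" by (rule lab_bij) simp
  have "(\<Sum>e\<in>out n v. g (rng B e)) =
      (\<Sum>w\<in>verts B (Suc n). \<Sum>e\<in>{e \<in> out n v. rng B e = w}. g (rng B e))"
    using bij_betw_finite [OF bij] finite_out
    by (intro sum.group [symmetric]) (auto simp: out_def rng_in_verts)
  also have "\<dots> = (\<Sum>w\<in>verts B (Suc n). real (card {e \<in> out n v. rng B e = w}) * g w)"
    by (intro sum.cong) simp_all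
  also have "\<dots> = (\<Sum>i\<in>UNIV. real (card {e \<in> out n v. rng B e = lab (Suc n) i}) * g (lab (Suc n) i))"
    by (rule sum.reindex_bij_betw [OF bij, symmetric])
  finally show ?thesis .
qed

text \<open>\<open>F\<close> is indexed by range, then source. Summing over the edges that leave a
  vertex runs down a column of \<open>F\<close>, which is why the transpose appears.\<close>

lemma sum_out_lab:
  assumes "1 \<le> n"
  shows "(\<Sum>e\<in>out n (lab n j). g (rng B e)) = (mat_A *v (\<chi> i. g (lab (Suc n) i))) $ j"
proof -
  have "card {e \<in> out n (lab n j). rng B e = lab (Suc n) i} = F $ i $ j" for i
    using incidence_eq [OF assms, of i j] by (simp add: incidence_def out_def conj_ac)
  then show ?thesis by (simp add: sum_out matrix_vector_mult_def mat_A_nth)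
qed

lemma height_lab: "height B (lab 1 i) = card {e \<in> edges B 0. rng B e = lab 1 i}"
  by (rule height_level_1) (simp add: lab_in_verts)

text \<open>The edges at the root are not described by \<open>F\<close>; there the vector
  \<open>hvec\<close> takes the place of the matrix.\<close>

lemma sum_out_root: "(\<Sum>e\<in>out 0 (root B). g (rng B e)) = hvec \<bullet> (\<chi> i. g (lab 1 i))"
proof -
  have "out 0 (root B) = edges B 0" using src_in_verts [of _ 0] by (auto simp: out_def verts_0)
  then show ?thesis
    unfolding sum_out by (simp add: inner_vec_def hvec_def height_lab del: One_nat_def)
      (simp only: One_nat_def)
qed

lemma hvec_pos: "0 < hvec $ i"
proof -
  have "lab 1 i \<in> rng B ` edges B 0" using rng_edges [of 0] lab_in_verts [of 1 i] by simp
  then have "{e \<in> edges B 0. rng B e = lab 1 i} \<noteq> {}" by force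
  then have "0 < height B (lab 1 i)"
    unfolding height_lab using finite_edges by (subst card_gt_0_iff) auto
  then show ?thesis by (simp add: hvec_def)
qed

lemma hvec_core_nonneg: "y \<in> core mat_A \<Longrightarrow> 0 \<le> hvec \<bullet> y"
  using hvec_pos core_nonneg by (auto simp: inner_vec_def less_imp_le intro!: sum_nonneg)

lemma hvec_core_eq_0: "y \<in> core mat_A \<Longrightarrow> hvec \<bullet> y = 0 \<Longrightarrow> y = 0"
  using hvec_pos core_nonneg
  by (auto simp: inner_vec_def less_imp_le sum_nonneg_eq_0_iff vec_eq_iff) (metis less_irrefl)

section \<open>Invariant measures as vectors of the core\<close>

definition weight :: "(nat \<Rightarrow> 'e) measure \<Rightarrow> 'v \<Rightarrow> real" where
  "weight \<mu> v = measure \<mu> (cylinder B (SOME es. es \<in> finite_paths B \<and> tip es = v))"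

definition level_vec :: "(nat \<Rightarrow> 'e) measure \<Rightarrow> nat \<Rightarrow> real^'n" where
  "level_vec \<mu> n = (\<chi> i. weight \<mu> (lab n i))"

text \<open>By invariance, the arbitrary path chosen in \<open>weight\<close> is immaterial.\<close>

lemma weight_tip:
  assumes "\<mu> \<in> invariant_probs B" "es \<in> finite_paths B"
  shows "weight \<mu> (tip es) = measure \<mu> (cylinder B es)"
proof -
  let ?es = "SOME es'. es' \<in> finite_paths B \<and> tip es' = tip es"
  have "?es \<in> finite_paths B \<and> tip ?es = tip es" by (rule someI [of _ es]) (simp add: assms)
  then show ?thesis using assms unfolding weight_def by (intro invariant_probsD(4)) auto
qed

lemma weight_root: "\<mu> \<in> invariant_probs B \<Longrightarrow> weight \<mu> (root B) = 1"
  using weight_tip [of \<mu> "[]"] invariant_probsD(1,2) [of \<mu>] prob_space.prob_space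
  by (fastforce simp: Nil_in_finite_paths tip_Nil cylinder_Nil)

lemma weight_out:
  assumes \<mu>: "\<mu> \<in> invariant_probs B" and v: "v \<in> verts B n"
  shows "weight \<mu> v = (\<Sum>e\<in>out n v. weight \<mu> (rng B e))"
proof -
  interpret prob_space \<mu> using invariant_probsD(1) [OF \<mu>] .
  obtain es where es: "es \<in> finite_paths B" "tip es = v" "length es = n"
    using path_to_vertex [OF v] by blast
  have snoc: "es @ [e] \<in> finite_paths B" if "e \<in> out n v" for e
    using es that by (simp add: snoc_in_finite_paths)
  have "weight \<mu> v = measure \<mu> (\<Union>e\<in>out n v. cylinder B (es @ [e]))"
    using weight_tip [OF \<mu> es(1)] cylinder_split [OF es(1)] es by simp
  also have "\<dots> = (\<Sum>e\<in>out n v. measure \<mu> (cylinder B (es @ [e])))"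
    using snoc disjoint_cylinder_snoc invariant_probsD(3) [OF \<mu>]
    by (intro finite_measure_finite_Union finite_out) (auto simp: cylinder_sets)
  also have "\<dots> = (\<Sum>e\<in>out n v. weight \<mu> (rng B e))"
    using weight_tip [OF \<mu> snoc] by (intro sum.cong) (simp_all add: tip_snoc)
  finally show ?thesis .
qed

lemma mat_A_level_vec: "\<mu> \<in> invariant_probs B \<Longrightarrow> 1 \<le> n \<Longrightarrow> mat_A *v level_vec \<mu> (Suc n) = level_vec \<mu> n"
  using weight_out [OF _ lab_in_verts] sum_out_lab [of n "weight \<mu>"]
  by (simp add: vec_eq_iff level_vec_def)

text \<open>Level \<open>n + k\<close> supplies a nonnegative preimage of order
  \<open>k\<close>.\<close>

lemma level_vec_in_core:
  assumes \<mu>: "\<mu> \<in> invariant_probs B" and n: "1 \<le> n"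
  shows "level_vec \<mu> n \<in> core mat_A"
  unfolding mem_core_iff
proof (intro allI impI)
  fix k :: nat
  have "level_vec \<mu> n = pow k (level_vec \<mu> (n + k))"
  proof (induction k)
    case (Suc k)
    then show ?case
      using mat_A_level_vec [OF \<mu>, of "n + k"] n by (simp add: funpow_Suc_right del: funpow.simps)
  qed simp
  then show "\<exists>y. (\<forall>i. 0 \<le> y $ i) \<and> level_vec \<mu> n = pow k y"
    by (intro exI conjI) (auto simp: level_vec_def weight_def)
qed

lemma hvec_level_vec: "\<mu> \<in> invariant_probs B \<Longrightarrow> hvec \<bullet> level_vec \<mu> 1 = 1"
  using weight_out [of \<mu> "root B" 0] sum_out_root [of "weight \<mu>"] weight_root [of \<mu>]
  by (simp add: verts_0 level_vec_def)

text \<open>The tower splits into cylinders of equal measure, one for each path to the vertex. This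
  identifies the vector of the theorem with \<open>level_vec \<mu> 1\<close>.\<close>

lemma tower_measure:
  assumes \<mu>: "\<mu> \<in> invariant_probs B"
  shows "measure \<mu> (tower B 1 (lab 1 w)) = hvec $ w * level_vec \<mu> 1 $ w"
proof -
  interpret prob_space \<mu> using invariant_probsD(1) [OF \<mu>] .
  have w: "lab 1 w \<in> verts B 1" by (simp add: lab_in_verts)
  have fin: "finite (paths_to B (lab 1 w))"
    unfolding paths_to_level_1 [OF w] using finite_edges by simp
  have disj: "disjoint_family_on (cylinder B) (paths_to B (lab 1 w))"
    unfolding paths_to_level_1 [OF w] by (auto simp: disjoint_family_on_def cylinder_def)
  have "cylinder B ` paths_to B (lab 1 w) \<subseteq> sets \<mu>"
    unfolding invariant_probsD(3) [OF \<mu>] by (auto simp: cylinder_sets paths_to_iff)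
  then have "measure \<mu> (tower B 1 (lab 1 w)) = (\<Sum>es\<in>paths_to B (lab 1 w). measure \<mu> (cylinder B es))"
    unfolding tower_1_eq [OF w] by (rule finite_measure_finite_Union [OF fin _ disj])
  also have "\<dots> = (\<Sum>es\<in>paths_to B (lab 1 w). weight \<mu> (lab 1 w))"
    using weight_tip [OF \<mu>] by (intro sum.cong refl) (metis paths_to_iff)
  also have "\<dots> = hvec $ w * level_vec \<mu> 1 $ w"
    by (simp add: height_def hvec_def level_vec_def)
  finally show ?thesis .
qed

lemma core_scaleR: "x \<in> core mat_A \<Longrightarrow> 0 \<le> c \<Longrightarrow> c *\<^sub>R x \<in> core mat_A"
  and core_add: "x \<in> core mat_A \<Longrightarrow> y \<in> core mat_A \<Longrightarrow> x + y \<in> core mat_A"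
  using convex_cone_core [of mat_A] by (simp_all add: convex_cone_iff)

text \<open>The relation climbs from one level to the next: both sides are vectors of the core with
  the same image under \<open>mat_A\<close>, which is injective there. Nonnegative coefficients keep
  the combination in the core, and \<open>a + b = 1\<close> handles the empty path.\<close>

lemma level_vec_determines:
  assumes inv: "\<mu>1 \<in> invariant_probs B" "\<mu>2 \<in> invariant_probs B" "\<mu>3 \<in> invariant_probs B"
    and ab: "0 \<le> a" "0 \<le> b" "a + b = 1"
    and eq: "a *\<^sub>R level_vec \<mu>1 1 + b *\<^sub>R level_vec \<mu>2 1 = level_vec \<mu>3 1"
    and S: "S \<in> sets (path_borel B)"
  shows "a * measure \<mu>1 S + b * measure \<mu>2 S = measure \<mu>3 S"
proof -
  have level: "a *\<^sub>R level_vec \<mu>1 n + b *\<^sub>R level_vec \<mu>2 n = level_vec \<mu>3 n" if "1 \<le> n" for n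
    using that
  proof (induction n rule: dec_induct)
    case base
    show ?case by (rule eq)
  next
    case (step n)
    let ?y = "a *\<^sub>R level_vec \<mu>1 (Suc n) + b *\<^sub>R level_vec \<mu>2 (Suc n)"
    have "mat_A *v ?y = mat_A *v level_vec \<mu>3 (Suc n)"
      using step inv mat_A_level_vec
      by (simp add: matrix_vector_right_distrib matrix_vector_mult_scaleR)
    moreover have "?y \<in> core mat_A"
      using inv ab by (intro core_add core_scaleR level_vec_in_core) auto
    moreover have "level_vec \<mu>3 (Suc n) \<in> core mat_A" using inv by (simp add: level_vec_in_core)
    ultimately show ?case using inj_on_core by (meson inj_onD)
  qed
  show ?thesis
  proof (rule measure_linear_relation [OF _ _ _ _ _ _ _ S])
    fix es assume es: "es \<in> finite_paths B"
    show "a * measure \<mu>1 (cylinder B es) + b * measure \<mu>2 (cylinder B es) = measure \<mu>3 (cylinder B es)"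
    proof (cases "es = []")
      case True
      then show ?thesis
        using weight_tip [OF inv(1) es] weight_tip [OF inv(2) es] weight_tip [OF inv(3) es]
          inv ab by (simp add: tip_Nil weight_root)
    next
      case False
      then have len: "1 \<le> length es" by (cases es) auto
      then obtain i where "tip es = lab (length es) i"
        using tip_in_verts [OF es] lab_bij [OF len] by (auto simp: bij_betw_def)
      then have "a * weight \<mu>1 (tip es) + b * weight \<mu>2 (tip es) = weight \<mu>3 (tip es)"
        using level [OF len] by (simp add: vec_eq_iff level_vec_def)
      then show ?thesis using inv es by (simp add: weight_tip)
    qed
  qed (use inv invariant_probsD in \<open>auto intro: prob_space.finite_measure\<close>)
qed

lemma level_vec_inj:
  assumes "\<mu> \<in> invariant_probs B" "\<nu> \<in> invariant_probs B" "level_vec \<mu> 1 = level_vec \<nu> 1"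
  shows "\<mu> = \<nu>"
proof (rule measure_eqI)
  show "sets \<mu> = sets \<nu>" using assms invariant_probsD(3) by simp
  fix S assume "S \<in> sets \<mu>"
  then have "S \<in> sets (path_borel B)" using assms invariant_probsD(3) by simp
  \<comment> \<open>A degenerate mixture of \<open>\<mu>\<close> with itself.\<close>
  then have "measure \<mu> S = measure \<nu> S"
    using level_vec_determines [OF assms(1,1,2), of 1 0] assms(3) by simp
  then show "emeasure \<mu> S = emeasure \<nu> S"
    using assms(1,2)[THEN invariant_probsD(1)]
    by (simp add: finite_measure.emeasure_eq_measure prob_space.finite_measure)
qed

text \<open>Preimages in the core are chosen one after another. They are the level vectors of a
  harmonic weight, whose Markov measure has the given first vector.\<close>

lemma level_vec_surj:
  assumes x: "x \<in> core mat_A" and norm: "hvec \<bullet> x = 1"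
  shows "\<exists>\<mu>\<in>invariant_probs B. level_vec \<mu> 1 = x"
proof -
  have "\<forall>y\<in>core mat_A. \<exists>z. z \<in> core mat_A \<and> mat_A *v z = y" using core_subset_image by blast
  from bchoice [OF this] obtain g
    where g: "\<And>y. y \<in> core mat_A \<Longrightarrow> g y \<in> core mat_A" "\<And>y. y \<in> core mat_A \<Longrightarrow> mat_A *v g y = y"
    by blast
  \<comment> \<open>Indexed so that \<open>q 1\<close> is \<open>x\<close>. The value
    \<open>q 0\<close> never serves as a level vector, since \<open>P\<close> gives the root weight
    1.\<close>
  define q where "q n = (g ^^ (n - 1)) x" for n
  have "(g ^^ k) x \<in> core mat_A" for k by (induction k) (use x g(1) in auto)
  then have q_core: "q n \<in> core mat_A" for n by (simp add: q_def)
  have q_step: "mat_A *v q (Suc n) = q n" if "1 \<le> n" for n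
    using that g(2) [OF q_core [of n]] by (cases n) (auto simp: q_def)
  define lev where "lev v = (THE n. v \<in> verts B n)" for v
  have lev: "lev v = n" if "v \<in> verts B n" for v n
    unfolding lev_def using that level_unique by blast
  define P where "P v = (if v = root B then 1 else q (lev v) $ inv (lab (lev v)) v)" for v
  have P_lab: "P (lab n i) = q n $ i" if n: "1 \<le> n" for n i
  proof -
    have "lab n i \<noteq> root B"
      using level_unique [OF lab_in_verts [OF n, of i], of 0] n by (auto simp: verts_0)
    moreover have "inj (lab n)" using lab_bij [OF n] by (simp add: bij_betw_def)
    ultimately show ?thesis using lev [OF lab_in_verts [OF n]] by (simp add: P_def)
  qed
  have "harmonic P"
    unfolding harmonic_def
  proof (intro conjI allI ballI)
    show root: "P (root B) = 1" by (simp add: P_def)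
    fix n v assume v: "v \<in> verts B n"
    have "0 \<le> P v \<and> P v = (\<Sum>e\<in>out n v. P (rng B e))"
    proof (cases "n = 0")
      case True
      have "(\<chi> i. P (lab 1 i)) = x" by (simp add: P_lab vec_eq_iff q_def)
      then show ?thesis
        using v True sum_out_root [of P] root norm by (simp add: verts_0)
    next
      case False
      then have n: "1 \<le> n" by simp
      obtain j where j: "v = lab n j" using v lab_bij [OF n] by (auto simp: bij_betw_def)
      have "(\<chi> i. P (lab (Suc n) i)) = q (Suc n)" by (simp add: P_lab vec_eq_iff)
      then show ?thesis
        using sum_out_lab [OF n, of P j] q_step [OF n] core_nonneg [OF q_core]
        by (simp add: j P_lab [OF n])
    qed
    then show "0 \<le> P v" "P v = (\<Sum>e\<in>out n v. P (rng B e))" by blast+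
  qed
  then obtain \<mu> where \<mu>: "\<mu> \<in> invariant_probs B"
    and cyl: "\<And>es. es \<in> finite_paths B \<Longrightarrow> measure \<mu> (cylinder B es) = P (tip es)"
    using harmonic_imp_invariant_prob by blast
  have "weight \<mu> (lab 1 i) = x $ i" for i
  proof -
    obtain es where es: "es \<in> finite_paths B" "tip es = lab 1 i"
      using path_to_vertex [OF lab_in_verts [of 1 i]] by auto
    then show ?thesis using weight_tip [OF \<mu> es(1)] cyl [OF es(1)] P_lab [of 1 i] by (simp add: q_def)
  qed
  then have "level_vec \<mu> 1 = x" by (simp add: level_vec_def vec_eq_iff)
  with \<mu> show ?thesis by blast
qed

section \<open>Ergodic measures and extreme rays\<close>

lemma ergodic_imp_extreme:
  assumes \<mu>: "\<mu> \<in> invariant_probs B" and erg: "ergodic B \<mu>"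
  shows "extreme_vector (level_vec \<mu> 1) (core mat_A)"
  unfolding extreme_vector_core_iff
proof (intro conjI ballI impI)
  let ?x = "level_vec \<mu> 1"
  show "?x \<in> core mat_A" using \<mu> by (simp add: level_vec_in_core)
  show "?x \<noteq> 0" using hvec_level_vec [OF \<mu>] by auto
  fix y assume y: "y \<in> core mat_A" and xy: "?x - y \<in> core mat_A"
  define t where "t = hvec \<bullet> y"
  have t': "hvec \<bullet> (?x - y) = 1 - t"
    using hvec_level_vec [OF \<mu>] by (simp add: inner_diff_right t_def)
  have "0 \<le> t" "0 \<le> 1 - t"
    using hvec_core_nonneg [OF y] hvec_core_nonneg [OF xy] t' by (simp_all add: t_def)
  \<comment> \<open>\<open>t\<close> is the mass of \<open>y\<close>. At the end points one of the
    two parts has mass 0 and vanishes, as \<open>hvec\<close> is positive; otherwise both parts can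
    be normalised and come from invariant measures.\<close>
  then consider "t = 0" | "t = 1" | "0 < t" "0 < 1 - t" by linarith
  then show "\<exists>a\<ge>0. y = a *\<^sub>R ?x"
  proof cases
    case 1
    then have "y = 0" using hvec_core_eq_0 [OF y] by (simp add: t_def)
    then show ?thesis by (intro exI [of _ 0]) simp
  next
    case 2
    then have "?x - y = 0" using hvec_core_eq_0 [OF xy] t' by simp
    then show ?thesis by (intro exI [of _ 1]) simp
  next
    case 3
    have "\<exists>\<nu>\<in>invariant_probs B. level_vec \<nu> 1 = (1 / t) *\<^sub>R y"
      using 3 y by (intro level_vec_surj core_scaleR) (auto simp: t_def)
    then obtain \<nu> where \<nu>: "\<nu> \<in> invariant_probs B" "level_vec \<nu> 1 = (1 / t) *\<^sub>R y" by blast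
    have "\<exists>\<nu>\<in>invariant_probs B. level_vec \<nu> 1 = (1 / (1 - t)) *\<^sub>R (?x - y)"
      using 3 xy t' by (intro level_vec_surj core_scaleR) auto
    then obtain \<nu>' where \<nu>': "\<nu>' \<in> invariant_probs B" "level_vec \<nu>' 1 = (1 / (1 - t)) *\<^sub>R (?x - y)"
      by blast
    have "t *\<^sub>R level_vec \<nu> 1 + (1 - t) *\<^sub>R level_vec \<nu>' 1 = ?x"
      unfolding \<nu>(2) \<nu>'(2) using 3 by simp
    then have mix: "t * measure \<nu> S + (1 - t) * measure \<nu>' S = measure \<mu> S"
      if "S \<in> sets (path_borel B)" for S
      using 3 that by (intro level_vec_determines [OF \<nu>(1) \<nu>'(1) \<mu>]) auto
    \<comment> \<open>In the mixture that gives \<open>\<mu>\<close>, the measure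
      \<open>\<nu>\<close> has the positive coefficient \<open>t\<close>, so it vanishes on every
      null set of \<open>\<mu>\<close>.\<close>
    have "absolutely_continuous \<mu> \<nu>"
      unfolding absolutely_continuous_def
    proof
      fix S assume "S \<in> null_sets \<mu>"
      then have S: "S \<in> sets (path_borel B)" and "measure \<mu> S = 0"
        using invariant_probsD(3) [OF \<mu>] by (auto simp: null_sets_def measure_def)
      then have "t * measure \<nu> S + (1 - t) * measure \<nu>' S = 0" using mix by simp
      then have "measure \<nu> S = 0"
        using 3 by (smt (verit) measure_nonneg mult_pos_pos mult_nonneg_nonneg)
      then show "S \<in> null_sets \<nu>"
        using S invariant_probsD(1,3) [OF \<nu>(1)]
        by (simp add: null_sets_def finite_measure.emeasure_eq_measure prob_space.finite_measure)
    qed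
    then have "\<nu> = \<mu>" by (rule ergodic_unique [OF \<mu> erg \<nu>(1)])
    then have "y = t *\<^sub>R ?x" using \<nu>(2) 3 by simp
    then show ?thesis using 3 by (intro exI [of _ t]) simp
  qed
qed

text \<open>A saturated set of intermediate measure would split \<open>\<mu>\<close> into its
  conditional measures on the set and on the complement, and the first vector into two vectors of
  the core. Extremality gives the first conditional measure the same vector as \<open>\<mu>\<close>,
  so it would equal \<open>\<mu>\<close>, although it is 0 on the complement.\<close>

lemma extreme_imp_ergodic:
  assumes \<mu>: "\<mu> \<in> invariant_probs B" and ext: "extreme_vector (level_vec \<mu> 1) (core mat_A)"
  shows "ergodic B \<mu>"
  unfolding ergodic_def
proof (intro ballI impI)
  interpret prob_space \<mu> using invariant_probsD(1) [OF \<mu>] .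
  note [simp] = invariant_probsD(2,3) [OF \<mu>]
  let ?x = "level_vec \<mu> 1"
  fix S assume "S \<in> sets \<mu>" and sat: "tail_equiv B `` S \<subseteq> S"
  then have S: "S \<in> sets (path_borel B)" by simp
  let ?T = "space \<mu> - S"
  have T: "?T \<in> sets (path_borel B)" using sets.compl_sets [OF S] by (simp add: space_path_borel)
  have sat': "tail_equiv B `` ?T \<subseteq> ?T"
  proof safe
    fix x y assume xy: "(x, y) \<in> tail_equiv B" and "x \<notin> S"
    then show "y \<in> space \<mu>" by (auto simp: tail_equiv_def)
    assume "y \<in> S"
    then show False using sat tail_equiv_sym [OF xy] \<open>x \<notin> S\<close> by blast
  qed
  show "measure \<mu> S = 0 \<or> measure \<mu> ?T = 0"
  proof (rule ccontr)
    assume "\<not> (measure \<mu> S = 0 \<or> measure \<mu> ?T = 0)"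
    then have pos: "measure \<mu> S \<noteq> 0" "measure \<mu> ?T \<noteq> 0" by auto
    let ?\<nu> = "uniform_measure \<mu> S" and ?\<nu>' = "uniform_measure \<mu> ?T"
    note \<nu> = saturated_restriction [OF \<mu> S sat pos(1)]
      and \<nu>' = saturated_restriction [OF \<mu> T sat' pos(2)]
    have "measure \<mu> S * weight ?\<nu> (lab 1 i) + measure \<mu> ?T * weight ?\<nu>' (lab 1 i) = weight \<mu> (lab 1 i)"
      for i
    proof -
      obtain es where es: "es \<in> finite_paths B" "tip es = lab 1 i"
        using path_to_vertex [OF lab_in_verts [of 1 i]] by auto
      have "measure \<mu> (S \<inter> cylinder B es) + measure \<mu> (?T \<inter> cylinder B es) =
          measure \<mu> (S \<inter> cylinder B es \<union> ?T \<inter> cylinder B es)"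
        using S T cylinder_sets [OF es(1)] by (intro finite_measure_Union [symmetric]) auto
      also have "S \<inter> cylinder B es \<union> ?T \<inter> cylinder B es = cylinder B es"
        using cylinder_subset by auto
      finally show ?thesis
        using pos weight_tip [OF \<mu> es(1)] weight_tip [OF \<nu>(1) es(1)] weight_tip [OF \<nu>'(1) es(1)]
          \<nu>(2) [OF cylinder_sets [OF es(1)]] \<nu>'(2) [OF cylinder_sets [OF es(1)]] es(2)
        by simp
    qed
    then have mix: "?x - measure \<mu> S *\<^sub>R level_vec ?\<nu> 1 = measure \<mu> ?T *\<^sub>R level_vec ?\<nu>' 1"
      by (simp add: vec_eq_iff level_vec_def algebra_simps)
    have "measure \<mu> S *\<^sub>R level_vec ?\<nu> 1 \<in> core mat_A"
      using \<nu>(1) by (intro core_scaleR level_vec_in_core) auto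
    moreover have "?x - measure \<mu> S *\<^sub>R level_vec ?\<nu> 1 \<in> core mat_A"
      unfolding mix using \<nu>'(1) by (intro core_scaleR level_vec_in_core) auto
    ultimately obtain a where a: "measure \<mu> S *\<^sub>R level_vec ?\<nu> 1 = a *\<^sub>R ?x"
      using ext unfolding extreme_vector_core_iff by blast
    have "a = measure \<mu> S"
      using arg_cong [OF a, of "\<lambda>v. hvec \<bullet> v"] hvec_level_vec [OF \<mu>] hvec_level_vec [OF \<nu>(1)] by simp
    then have "level_vec ?\<nu> 1 = ?x" using a pos(1) by simp
    then have "?\<nu> = \<mu>" by (rule level_vec_inj [OF \<nu>(1) \<mu>])
    then have "measure \<mu> ?T = measure \<mu> (S \<inter> ?T) / measure \<mu> S" using \<nu>(2) [OF T] by simp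
    then show False using pos(2) by simp
  qed
qed

end

theorem theorem3p8:
  fixes B :: "('v, 'e) bratteli"
    and lab :: "nat \<Rightarrow> 'n::finite \<Rightarrow> 'v"
    and F :: "nat^'n^'n"
    and A :: "real^'n^'n"
    and h :: "'n \<Rightarrow> real"
    and D \<Xi> :: "(real^'n) set"
    and p :: "(nat \<Rightarrow> 'e) measure \<Rightarrow> real^'n"
  assumes "bratteli_diagram B"
    and "stationary B lab F"
    and "aperiodic B"
    and "condition_P F"
  defines "A \<equiv> transpose (map_matrix real F)"
    and "h \<equiv> (\<lambda>w. real (height B (lab 1 w)))"
    and "D \<equiv> {x \<in> core A. (\<Sum>w\<in>UNIV. h w * x $ w) = 1}"
    and "\<Xi> \<equiv> {x. extreme_vector x (core A) \<and> (\<Sum>w\<in>UNIV. h w * x $ w) = 1}"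
    and "p \<equiv> (\<lambda>\<mu>. \<chi> w. measure \<mu> (tower B 1 (lab 1 w)) / h w)"
  shows "bij_betw p (invariant_probs B) D \<and>
    finite \<Xi> \<and>
    bij_betw p {\<mu> \<in> invariant_probs B. ergodic B \<mu>} \<Xi> \<and>
    finite {\<mu> \<in> invariant_probs B. ergodic B \<mu>} \<and>
    card {\<mu> \<in> invariant_probs B. ergodic B \<mu>} = card \<Xi>"
proof -
  interpret stationary_diagram B lab F
    by unfold_locales (use assms in auto)
  have A: "A = mat_A" by (simp add: A_def mat_A_def)
  have h: "(\<Sum>w\<in>UNIV. h w * x $ w) = hvec \<bullet> x" for x
    by (simp add: h_def hvec_def inner_vec_def)
  have D: "D = {x \<in> core mat_A. hvec \<bullet> x = 1}" by (simp add: D_def A h)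
  have \<Xi>: "\<Xi> = {x. extreme_vector x (core mat_A) \<and> hvec \<bullet> x = 1}" by (simp add: \<Xi>_def A h)
  have p: "p \<mu> = level_vec \<mu> 1" if "\<mu> \<in> invariant_probs B" for \<mu>
  proof -
    have "h w = hvec $ w" for w by (simp add: h_def hvec_def)
    then show ?thesis
      using hvec_pos tower_measure [OF that] by (simp add: p_def vec_eq_iff less_imp_neq [symmetric])
  qed
  have inj: "inj_on p (invariant_probs B)"
    using level_vec_inj by (auto simp: inj_on_def p)
  have "p ` invariant_probs B = D"
    using level_vec_in_core hvec_level_vec level_vec_surj p unfolding D image_def by fastforce
  with inj have "bij_betw p (invariant_probs B) D" by (simp add: bij_betw_def)
  moreover have fin: "finite \<Xi>"
    unfolding \<Xi> by (rule finite_extreme_vectors_core) (rule hvec_pos)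
  moreover have bij: "bij_betw p {\<mu> \<in> invariant_probs B. ergodic B \<mu>} \<Xi>"
    unfolding bij_betw_def
  proof
    show "inj_on p {\<mu> \<in> invariant_probs B. ergodic B \<mu>}"
      using inj by (rule inj_on_subset) blast
    show "p ` {\<mu> \<in> invariant_probs B. ergodic B \<mu>} = \<Xi>"
    proof
      show "p ` {\<mu> \<in> invariant_probs B. ergodic B \<mu>} \<subseteq> \<Xi>"
        using ergodic_imp_extreme hvec_level_vec p by (auto simp: \<Xi>)
      show "\<Xi> \<subseteq> p ` {\<mu> \<in> invariant_probs B. ergodic B \<mu>}"
      proof
        fix x assume x: "x \<in> \<Xi>"
        \<comment> \<open>A normalised extreme vector is in particular a normalised vector of the
          core, so some invariant measure has it as its first vector.\<close>
        then obtain \<mu> where \<mu>: "\<mu> \<in> invariant_probs B" "level_vec \<mu> 1 = x"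
          using level_vec_surj unfolding \<Xi> extreme_vector_def by blast
        then have "ergodic B \<mu>" using extreme_imp_ergodic x by (simp add: \<Xi>)
        then show "x \<in> p ` {\<mu> \<in> invariant_probs B. ergodic B \<mu>}" using \<mu> p by force
      qed
    qed
  qed
  ultimately show ?thesis
    using bij_betw_finite [OF bij] bij_betw_same_card [OF bij] by blast
qed

end
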